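(* Let $A$ be a finite set of rational numbers with $|AA|\le K|A|$ and let $u\in\mathbb{Q}$ be non-zero. Then for every integer $k\ge2$, \[|(A+u)^{(k)}|\ge\frac{|A|^{k-1}}{K^k\left(2\binom{2k}{2}\right)^{Kk}}.\]
   Context: $AA=\{ab:a,b\in A\}$; $X^{(k)}=\{x_1\cdots x_k:x_i\in X\}$; $A+u=\{a+u:a\in A\}$. *)

theory Defs
  imports "HOL-Analysis.Analysis"
begin

definition prod_set :: "rat set \<Rightarrow> rat set" where
  "prod_set A = {a * b | a b. a \<in> A \<and> b \<in> A}"

definition k_fold_prod :: "rat set \<Rightarrow> nat \<Rightarrow> rat set" where
  "k_fold_prod X k = {prod_list xs | xs. length xs = k \<and> set xs \<subseteq> X}"

definition translate :: "rat set \<Rightarrow> rat \<Rightarrow> rat set" where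
  "translate A u = (\<lambda>a. a + u) ` A"

end

theory Submission
  imports Defs "HOL-Computational_Algebra.Primes" "HOL-Library.Function_Algebras"
begin

text \<open>
  Discarding \<open>0\<close> and \<open>- u\<close> and dividing by \<open>u\<close>, we have to bound the products of the
  \<open>1 + b\<close>, \<open>b \<in> B\<close>. Instead of these products we count the pairs
  \<open>(b\<^sub>1 \<cdots> b\<^sub>k, (1 + b\<^sub>1) \<cdots> (1 + b\<^sub>k))\<close>; by Pluennecke's inequality the first component takes at
  most \<open>K\<^sup>k\<close>\<open>card B\<close> values. By Cauchy--Schwarz the number of pairs is controlled by the number
  of coincidences between two \<open>k\<close>-tuples (the energy). The joint condition is invariant
  under \<open>b \<mapsto> 1/b\<close>, which is what makes negative valuations tractable: for a prime \<open>p\<close>, a coincidence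
  among elements of nonnegative \<open>p\<close>-adic valuation attains the least valuation at least twice, since
  otherwise the two sides differ modulo the next power of \<open>p\<close>. By Hoelder's inequality, splitting
  \<open>B\<close> according to the valuation at \<open>p\<close> costs only the factor \<open>2 * ((2 k) choose 2)\<close> in the
  \<open>k\<close>-th root of the energy. Finally Freiman's lemma shows that fewer than \<open>K\<close> primes suffice to
  separate the elements of \<open>B\<close> up to sign, unless \<open>A\<close> is so small that the bound is trivial.
\<close>

section \<open>Valuations of rational numbers\<close>

text \<open>The \<open>p\<close>-adic valuation, read off the reduced fraction. At 0 it takes the
  default value 0 instead of infinity.\<close>

definition vp :: "int \<Rightarrow> rat \<Rightarrow> int" where
  "vp p x = int (multiplicity p (fst (quotient_of x))) - int (multiplicity p (snd (quotient_of x)))"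

text \<open>The fraction need not be reduced: cross-multiply with the reduced one and use that
  multiplicities add under products.\<close>

lemma vp_divide_ints:
  fixes a b :: int
  assumes "prime p" "a \<noteq> 0" "b \<noteq> 0"
  shows "vp p (of_int a / of_int b) = int (multiplicity p a) - int (multiplicity p b)"
proof -
  obtain m n where q: "quotient_of (of_int a / of_int b) = (m, n)" by fastforce
  have n: "n > 0" using q by (rule quotient_of_denom_pos)
  have e: "(of_int a / of_int b :: rat) = of_int m / of_int n" using q by (rule quotient_of_div)
  then have "(of_int (a * n) :: rat) = of_int (m * b)"
    using assms n by (simp add: field_simps)
  then have e2: "a * n = m * b" by (simp only: of_int_eq_iff)
  then have "m \<noteq> 0" using assms n by auto
  then have "multiplicity p a + multiplicity p n = multiplicity p m + multiplicity p b"
    using e2 assms n prime_elem_multiplicity_mult_distrib[of p a n]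
      prime_elem_multiplicity_mult_distrib[of p m b] by auto
  then show ?thesis unfolding vp_def q by simp
qed

lemma rat_as_quotient:
  fixes x :: rat
  assumes "x \<noteq> 0"
  obtains a b :: int where "a \<noteq> 0" "b > 0" "coprime a b" "x = of_int a / of_int b"
proof -
  obtain m n where q: "quotient_of x = (m, n)" by fastforce
  show thesis
    using that[of m n] quotient_of_denom_pos[OF q] quotient_of_div[OF q] quotient_of_coprime[OF q] assms
    by auto
qed

lemma vp_mult:
  assumes "prime p" "x \<noteq> 0" "y \<noteq> 0"
  shows "vp p (x * y) = vp p x + vp p y"
proof -
  obtain a b where x: "a \<noteq> 0" "b > 0" "x = of_int a / of_int b" using rat_as_quotient assms by metis
  obtain c d where y: "c \<noteq> 0" "d > 0" "y = of_int c / of_int d" using rat_as_quotient assms by metis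
  have e: "x * y = of_int (a * c) / of_int (b * d)" using x y by simp
  show ?thesis
    unfolding e using x y assms prime_elem_multiplicity_mult_distrib[OF prime_imp_prime_elem, of p a c]
      prime_elem_multiplicity_mult_distrib[OF prime_imp_prime_elem, of p b d]
    by (simp add: vp_divide_ints del: of_int_mult)
qed

lemma vp_one [simp]: "prime p \<Longrightarrow> vp p 1 = 0"
  using vp_mult[of p 1 1] by simp

lemma vp_uminus: "prime p \<Longrightarrow> x \<noteq> 0 \<Longrightarrow> vp p (- x) = vp p x"
  using vp_mult[of p "-1" "-1"] vp_mult[of p "-1" x] by simp

lemma vp_abs: "prime p \<Longrightarrow> x \<noteq> 0 \<Longrightarrow> vp p \<bar>x\<bar> = vp p x"
  by (simp add: abs_if vp_uminus)

lemma vp_inverse: "prime p \<Longrightarrow> x \<noteq> 0 \<Longrightarrow> vp p (inverse x) = - vp p x"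
  using vp_mult[of p x "inverse x"] by simp

text \<open>Over a common denominator only numerators matter, and a power of \<open>p\<close>
  dividing both of them divides their sum.\<close>

lemma vp_add_ge:
  assumes "prime p" "x \<noteq> 0" "y \<noteq> 0" "x + y \<noteq> 0" "j \<le> vp p x" "j \<le> vp p y"
  shows "j \<le> vp p (x + y)"
proof -
  obtain a b where x: "a \<noteq> 0" "b > 0" "x = of_int a / of_int b" using rat_as_quotient assms by metis
  obtain c d where y: "c \<noteq> 0" "d > 0" "y = of_int c / of_int d" using rat_as_quotient assms by metis
  have ex: "x = of_int (a * d) / of_int (b * d)" and ey: "y = of_int (c * b) / of_int (b * d)"
    using x y by auto
  have exy: "x + y = of_int (a * d + c * b) / of_int (b * d)"
    unfolding ex ey by (simp add: add_divide_distrib)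
  have nz: "a * d + c * b \<noteq> 0"
  proof
    assume "a * d + c * b = 0"
    then show False using assms(4) unfolding exy by (simp del: of_int_add of_int_mult)
  qed
  have vx: "vp p x = int (multiplicity p (a * d)) - int (multiplicity p (b * d))"
    unfolding ex using x y assms by (intro vp_divide_ints) auto
  have vy: "vp p y = int (multiplicity p (c * b)) - int (multiplicity p (b * d))"
    unfolding ey using x y assms by (intro vp_divide_ints) auto
  have vxy: "vp p (x + y) = int (multiplicity p (a * d + c * b)) - int (multiplicity p (b * d))"
    unfolding exy using x y assms nz by (intro vp_divide_ints) auto
  define m where "m = min (multiplicity p (a * d)) (multiplicity p (c * b))"
  have "p ^ m dvd a * d" "p ^ m dvd c * b"
    by (auto simp: m_def intro!: multiplicity_dvd')
  then have "p ^ m dvd a * d + c * b" by (rule dvd_add)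
  moreover have "\<not> is_unit p" using \<open>prime p\<close> by auto
  ultimately have "m \<le> multiplicity p (a * d + c * b)" using nz by (intro multiplicity_geI) auto
  then show ?thesis using assms(5,6) vx vy vxy by (simp add: m_def min_def split: if_splits)
qed

text \<open>Unique factorisation: numerator and denominator have equal multiplicities at every
  prime, hence are associated.\<close>

lemma abs_eq_one_if_vp_zero:
  assumes "x \<noteq> 0" "\<And>p. prime p \<Longrightarrow> vp p x = 0"
  shows "\<bar>x\<bar> = 1"
proof -
  obtain a b where x: "a \<noteq> 0" "b > 0" "x = of_int a / of_int b" using rat_as_quotient assms by metis
  have "multiplicity p a = multiplicity p b" if "prime p" for p
    using assms(2)[OF that] that x by (simp add: vp_divide_ints)
  then have "normalize a = normalize b" using x by (intro multiplicity_eq_imp_eq) auto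
  then have "\<bar>a\<bar> = \<bar>b\<bar>" by simp
  then have "\<bar>rat_of_int a\<bar> = \<bar>of_int b\<bar>" by (metis of_int_abs)
  then show ?thesis using x by (simp add: abs_divide)
qed

lemma abs_eq_if_vp_eq:
  assumes "x \<noteq> 0" "y \<noteq> 0" "\<And>p. prime p \<Longrightarrow> vp p x = vp p y"
  shows "\<bar>x\<bar> = \<bar>y\<bar>"
proof -
  have "\<bar>x * inverse y\<bar> = 1"
    using assms by (intro abs_eq_one_if_vp_zero) (auto simp: vp_mult vp_inverse)
  then show ?thesis using assms by (simp add: abs_mult field_simps)
qed

section \<open>Coordinates that determine the vectors of a span\<close>

interpretation ratfun: vector_space "\<lambda>(c::rat) (f :: 'p \<Rightarrow> rat) p. c * f p"
  by unfold_locales (auto simp: fun_eq_iff algebra_simps)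

text \<open>Restriction to \<open>Q\<close> is injective on the span. The least size of such a
  \<open>Q\<close> serves as the dimension, and \<open>Q\<close> itself later supplies the
  primes.\<close>

definition determines :: "'p set \<Rightarrow> ('p \<Rightarrow> rat) set \<Rightarrow> bool" where
  "determines Q V \<longleftrightarrow> (\<forall>w \<in> ratfun.span V. (\<forall>p\<in>Q. w p = 0) \<longrightarrow> w = 0)"

lemma determines_mono_span:
  assumes "determines Q V" "W \<subseteq> ratfun.span V"
  shows "determines Q W"
  using ratfun.span_minimal[OF assms(2)] assms(1) unfolding determines_def by auto

text \<open>If \<open>Q\<close> fails for the enlarged span, some \<open>w0\<close> there vanishes
  on \<open>Q\<close> but not at some \<open>q\<close>. Every vector vanishing on \<open>Q\<close>
  is then a multiple of \<open>w0\<close>, hence zero once it vanishes at \<open>q\<close>.\<close>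

lemma determines_insert:
  assumes "determines Q V"
  shows "\<exists>q. determines (insert q Q) (insert z V)"
proof (cases "determines Q (insert z V)")
  case True
  then show ?thesis unfolding determines_def by blast
next
  case False
  then obtain w0 q where w0: "w0 \<in> ratfun.span (insert z V)" "\<forall>p\<in>Q. w0 p = 0" "w0 q \<noteq> 0"
    unfolding determines_def by (metis ext zero_fun_def)
  then obtain s0 where s0: "w0 - (\<lambda>p. s0 * z p) \<in> ratfun.span V"
    unfolding ratfun.span_breakdown_eq by auto
  have s0nz: "s0 \<noteq> 0"
  proof
    assume "s0 = 0"
    then have "w0 \<in> ratfun.span V" using s0 by (simp add: fun_diff_def)
    then show False using w0 assms unfolding determines_def by fastforce
  qed
  have "w = 0" if w: "w \<in> ratfun.span (insert z V)" "\<forall>p\<in>insert q Q. w p = 0" for w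
  proof -
    obtain s where s: "w - (\<lambda>p. s * z p) \<in> ratfun.span V"
      using w unfolding ratfun.span_breakdown_eq by auto
    \<comment> \<open>The multiple of \<open>w0\<close> is chosen to cancel \<open>z\<close>, so the
      difference lies in the span of \<open>V\<close>.\<close>
    have "(w - (\<lambda>p. s * z p)) - (\<lambda>p. (s / s0) * (w0 - (\<lambda>p. s0 * z p)) p) \<in> ratfun.span V"
      by (intro ratfun.span_diff s ratfun.span_scale s0)
    also have "(w - (\<lambda>p. s * z p)) - (\<lambda>p. (s / s0) * (w0 - (\<lambda>p. s0 * z p)) p)
        = (\<lambda>p. w p - (s / s0) * w0 p)"
      using s0nz by (auto simp: fun_eq_iff algebra_simps)
    finally have "(\<lambda>p. w p - (s / s0) * w0 p) = 0"
      using assms w w0 unfolding determines_def by auto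
    then have eq: "w p = (s / s0) * w0 p" for p by (simp add: fun_eq_iff)
    then have "s / s0 = 0" using w w0 by (metis insertI1 mult_eq_0_iff)
    then have "w p = 0" for p unfolding eq by (simp only: mult_zero_left)
    then show "w = 0" by (simp add: fun_eq_iff)
  qed
  then show ?thesis unfolding determines_def by blast
qed

text \<open>The coordinate \<open>r\<close> alone determines the span of the first vector, and each
  further vector adds at most one coordinate. It is applied with \<open>r = None\<close>, where
  every \<open>val_vec\<close> is 1.\<close>

lemma determining_set_exists:
  assumes "finite V" "V \<noteq> {}" "\<And>z. z \<in> V \<Longrightarrow> z r \<noteq> 0"
  shows "\<exists>Q. finite Q \<and> r \<in> Q \<and> card Q \<le> card V \<and> determines Q V"
  using assms
proof (induction V rule: finite_ne_induct)
  case (singleton z)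
  have "determines {r} {z}"
    unfolding determines_def using singleton
    by (auto simp: ratfun.span_singleton fun_eq_iff)
  then show ?case by (intro exI[of _ "{r}"]) auto
next
  case (insert z V)
  then obtain Q where Q: "finite Q" "r \<in> Q" "card Q \<le> card V" "determines Q V" by auto
  obtain q where "determines (insert q Q) (insert z V)" using determines_insert Q by blast
  then show ?case using Q insert by (intro exI[of _ "insert q Q"]) (auto simp: card_insert_if)
qed

text \<open>The coordinate \<open>None\<close> homogenises: affine relations between valuation vectors become
  linear relations.\<close>

definition val_vec :: "rat \<Rightarrow> int option \<Rightarrow> rat" where
  "val_vec a q = (case q of None \<Rightarrow> 1 | Some p \<Rightarrow> if prime p then of_int (vp p a) else 0)"

lemma val_vec_None [simp]: "val_vec a None = 1"
  by (simp add: val_vec_def)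

lemma val_vec_eqI: "a \<noteq> 0 \<Longrightarrow> b \<noteq> 0 \<Longrightarrow> \<bar>a\<bar> = \<bar>b\<bar> \<Longrightarrow> val_vec a = val_vec b"
  by (auto simp: val_vec_def fun_eq_iff abs_eq_iff vp_uminus split: option.split)

text \<open>Valuations ignore signs and turn products into sums; at \<open>None\<close> the relation
  reads \<open>1 = 1 + 1 - 1\<close>.\<close>

lemma val_vec_relation:
  assumes "a \<noteq> 0" "b \<noteq> 0" "c \<noteq> 0" "d \<noteq> 0" "\<bar>a * b\<bar> = \<bar>c * d\<bar>"
  shows "val_vec a = val_vec c + val_vec d - val_vec b"
proof -
  have "vp p a + vp p b = vp p c + vp p d" if "prime p" for p
    using vp_abs[OF that, of "a * b"] vp_abs[OF that, of "c * d"] assms that by (simp add: vp_mult)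
  then have "rat_of_int (vp p a) = of_int (vp p c) + of_int (vp p d) - of_int (vp p b)"
    if "prime p" for p using that by (metis add_diff_cancel_right' of_int_add)
  then show ?thesis by (auto simp: val_vec_def fun_eq_iff split: option.split)
qed

text \<open>The difference of two vectors \<open>val_vec\<close> vanishes at \<open>None\<close>
  automatically, so the primes in \<open>Q\<close> alone separate elements up to sign.\<close>

lemma determines_imp_abs_eq:
  assumes "determines Q (val_vec ` A)" "a \<in> A" "b \<in> A" "a \<noteq> 0" "b \<noteq> 0"
    and "\<And>p. Some p \<in> Q \<Longrightarrow> prime p \<Longrightarrow> vp p a = vp p b"
  shows "\<bar>a\<bar> = \<bar>b\<bar>"
proof -
  have "val_vec a - val_vec b \<in> ratfun.span (val_vec ` A)"
    using assms by (intro ratfun.span_diff ratfun.span_base) auto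
  moreover have "\<forall>q\<in>Q. (val_vec a - val_vec b) q = 0"
    using assms(6) by (auto simp: val_vec_def split: option.split)
  ultimately have "val_vec a - val_vec b = 0" using assms(1) unfolding determines_def by blast
  then have eq: "val_vec a (Some p) = val_vec b (Some p)" for p by (simp add: fun_eq_iff)
  have "vp p a = vp p b" if "prime p" for p
    using eq[of p] that by (simp add: val_vec_def)
  then show ?thesis using assms abs_eq_if_vp_eq by blast
qed

section \<open>Freiman's lemma\<close>

lemma finite_prod_set: "finite A \<Longrightarrow> finite (prod_set A)"
proof -
  assume "finite A"
  moreover have "prod_set A = (\<lambda>(a, b). a * b) ` (A \<times> A)" by (auto simp: prod_set_def)
  ultimately show ?thesis by simp
qed

lemma prod_set_mono: "A \<subseteq> B \<Longrightarrow> prod_set A \<subseteq> prod_set B"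
  by (auto simp: prod_set_def)

lemma card_le_card_prod_set:
  assumes "finite A" "0 \<notin> A"
  shows "card A \<le> card (prod_set A)"
proof (cases "A = {}")
  case False
  then obtain a where a: "a \<in> A" by auto
  have "card A = card ((*) a ` A)"
    using a assms by (intro card_image[symmetric] inj_onI) auto
  also have "\<dots> \<le> card (prod_set A)"
    using a assms by (intro card_mono finite_prod_set) (auto simp: prod_set_def)
  finally show ?thesis .
qed simp

text \<open>If \<open>v\<close> has maximal absolute value, then \<open>v * i\<close> is a new product precisely when \<open>i\<close> is
  irreducible relative to \<open>v\<close>, i.e. \<open>\<bar>v * i\<bar>\<close> is not \<open>\<bar>b * c\<bar>\<close> with smaller \<open>b\<close>, \<open>c\<close>. The
  irreducible elements span everything, hence there are at least as many as the dimension.\<close>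

lemma irreducibles_span:
  assumes "finite A'" "v \<noteq> 0" "0 \<notin> A'" "\<And>a. a \<in> A' \<Longrightarrow> \<bar>a\<bar> < \<bar>v\<bar>"
    and I: "I = {i \<in> A'. \<forall>b\<in>A'. \<forall>c\<in>A'. \<bar>v * i\<bar> \<noteq> \<bar>b * c\<bar>}"
  shows "val_vec ` A' \<subseteq> ratfun.span (val_vec ` insert v I)"
proof -
  have "val_vec a \<in> ratfun.span (val_vec ` insert v I)" if "a \<in> A'" for a
    using that
  proof (induction "card {x \<in> A'. \<bar>a\<bar> < \<bar>x\<bar>}" arbitrary: a rule: less_induct)
    case less
    show ?case
    proof (cases "a \<in> I")
      case True
      then show ?thesis by (intro ratfun.span_base) auto
    next
      case False
      then obtain b c where bc: "b \<in> A'" "c \<in> A'" "\<bar>v * a\<bar> = \<bar>b * c\<bar>"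
        using less.prems I by auto
      have nz: "a \<noteq> 0" "b \<noteq> 0" "c \<noteq> 0" using bc less.prems assms by auto
      have bigger: "\<bar>a\<bar> < \<bar>y\<bar>" if "y \<in> A'" "z \<in> A'" "\<bar>v * a\<bar> = \<bar>y * z\<bar>" for y z
      proof (rule ccontr)
        assume "\<not> \<bar>a\<bar> < \<bar>y\<bar>"
        then have "\<bar>y\<bar> * \<bar>z\<bar> \<le> \<bar>a\<bar> * \<bar>z\<bar>" by (intro mult_right_mono) auto
        also have "\<dots> < \<bar>a\<bar> * \<bar>v\<bar>" using assms(4)[OF that(2)] nz by simp
        finally show False using that(3) by (simp add: abs_mult mult.commute)
      qed
      have "card {x \<in> A'. \<bar>y\<bar> < \<bar>x\<bar>} < card {x \<in> A'. \<bar>a\<bar> < \<bar>x\<bar>}"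
        if "y \<in> A'" "\<bar>a\<bar> < \<bar>y\<bar>" for y
        using that assms(1) by (intro psubset_card_mono) auto
      moreover have "\<bar>a\<bar> < \<bar>b\<bar>" "\<bar>a\<bar> < \<bar>c\<bar>"
        using bigger[of b c] bigger[of c b] bc by (auto simp: mult.commute)
      ultimately have "val_vec b \<in> ratfun.span (val_vec ` insert v I)"
          "val_vec c \<in> ratfun.span (val_vec ` insert v I)"
        using less.hyps bc by auto
      moreover have "val_vec v \<in> ratfun.span (val_vec ` insert v I)"
        by (intro ratfun.span_base) simp
      moreover have "val_vec a = val_vec b + val_vec c - val_vec v"
        using nz assms(2) bc(3) by (intro val_vec_relation) (simp_all add: mult.commute)
      ultimately show ?thesis
        by (simp only: ratfun.span_diff ratfun.span_add)
    qed
  qed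
  then show ?thesis by auto
qed

text \<open>For nonempty \<open>A\<close> the hypothesis says that the valuation vectors span more
  than \<open>d\<close> dimensions. The error term is twice the classical
  \<open>d * (d + 1) / 2\<close>, because \<open>a\<close> and \<open>- a\<close> share a vector.
  The induction removes the elements of largest absolute value and counts the products that they
  contribute.\<close>

lemma freiman_lemma:
  assumes "finite A" "0 \<notin> A"
    and "\<And>Q. finite Q \<Longrightarrow> None \<in> Q \<Longrightarrow> card Q \<le> d \<Longrightarrow> \<not> determines Q (val_vec ` A)"
  shows "(d + 1) * card A \<le> card (prod_set A) + d * (d + 1)"
  using assms
proof (induction "card A" arbitrary: A d rule: less_induct)
  case less
  show ?case
  proof (cases "A = {} \<or> d = 0")
    case True
    then show ?thesis using card_le_card_prod_set[OF less.prems(1,2)] by auto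
  next
    case False
    then obtain e where d: "d = Suc e" by (cases d) auto
    define M where "M = Max (abs ` A)"
    define T where "T = {a \<in> A. \<bar>a\<bar> = M}"
    define A' where "A' = {a \<in> A. \<bar>a\<bar> < M}"
    have le: "\<bar>a\<bar> \<le> M" if "a \<in> A" for a
      using that less.prems(1) by (simp add: M_def)
    have "M \<in> abs ` A" unfolding M_def using False less.prems(1) by (intro Max_in) auto
    then obtain v where v: "v \<in> A" "\<bar>v\<bar> = M" by auto
    have nz: "v \<noteq> 0" "M > 0" using v less.prems(2) by auto
    have AT: "A = A' \<union> T" using le by (auto simp: T_def A'_def order_less_le)
    have disj: "A' \<inter> T = {}" by (auto simp: T_def A'_def)
    have fin: "finite A'" "finite T" using less.prems(1) by (auto simp: T_def A'_def)
    have cardA: "card A = card A' + card T" unfolding AT using fin disj by (rule card_Un_disjoint)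
    have Tv: "v \<in> T" using v by (simp add: T_def)
    have "T \<subseteq> {v, - v}" using v by (auto simp: T_def abs_eq_iff)
    then have "card T \<le> card {v, - v}" by (intro card_mono) auto
    also have "\<dots> \<le> 2" by (simp add: card_insert_if)
    finally have T2: "card T \<le> 2" .
    have "card T > 0" using Tv fin by (auto simp: card_gt_0_iff)
    then have smaller: "card A' < card A" using cardA by simp
    have A'0: "0 \<notin> A'" using less.prems(2) by (auto simp: A'_def)
    have A'lt: "\<bar>a\<bar> < \<bar>v\<bar>" if "a \<in> A'" for a using that v by (simp add: A'_def)
    have valT: "val_vec t = val_vec v" if "t \<in> T" for t
      using that v nz by (intro val_vec_eqI) (auto simp: T_def)
    have sub: "val_vec ` A \<subseteq> insert (val_vec v) (val_vec ` A')" using AT valT by auto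
    have new_le: "card (prod_set A') + card N \<le> card (prod_set A)"
      if "N \<subseteq> prod_set A" "N \<inter> prod_set A' = {}" for N
    proof -
      have "card (prod_set A') + card N = card (prod_set A' \<union> N)"
        using that fin finite_subset[OF that(1) finite_prod_set[OF less.prems(1)]]
        by (intro card_Un_disjoint[symmetric] finite_prod_set) auto
      also have "\<dots> \<le> card (prod_set A)"
        using that prod_set_mono[of A' A] AT less.prems(1) by (intro card_mono finite_prod_set) auto
      finally show ?thesis .
    qed
    have big: "\<bar>t * s\<bar> \<noteq> \<bar>b * c\<bar>" if "t \<in> T" "s \<in> T" "b \<in> A'" "c \<in> A'" for t s b c
    proof -
      have "\<bar>b\<bar> * \<bar>c\<bar> < M * M"
        using that by (intro mult_strict_mono) (auto simp: A'_def)
      then show ?thesis using that by (simp add: abs_mult T_def)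
    qed
    \<comment> \<open>Either removing \<open>T\<close> brings the dimension down to at most
      \<open>d\<close>, and every \<open>v * a\<close> is a new product, or it does not, and the
      irreducible elements supply the new products.\<close>
    show ?thesis
    proof (cases "\<exists>Q. finite Q \<and> None \<in> Q \<and> card Q \<le> d \<and> determines Q (val_vec ` A')")
      case True
      then obtain Q where Q: "finite Q" "None \<in> Q" "card Q \<le> d" "determines Q (val_vec ` A')"
        by auto
      \<comment> \<open>Such a relation would put \<open>val_vec v\<close> into the span of the
        rest, and at most \<open>d\<close> coordinates would determine all of
        \<open>A\<close>.\<close>
      have irred: "\<bar>v * a\<bar> \<noteq> \<bar>b * c\<bar>" if "a \<in> A'" "b \<in> A'" "c \<in> A'" for a b c
      proof
        assume eq: "\<bar>v * a\<bar> = \<bar>b * c\<bar>"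
        have "val_vec v = val_vec b + val_vec c - val_vec a"
          using that nz A'0 eq by (intro val_vec_relation) auto
        also have "\<dots> \<in> ratfun.span (val_vec ` A')"
          using that by (intro ratfun.span_diff ratfun.span_add ratfun.span_base imageI)
        finally have "val_vec v \<in> ratfun.span (val_vec ` A')" .
        then have "val_vec ` A \<subseteq> ratfun.span (val_vec ` A')"
          using subset_trans[OF sub] ratfun.span_superset[of "val_vec ` A'"] by simp
        then have "determines Q (val_vec ` A)" using Q(4) determines_mono_span by blast
        then show False using less.prems(3) Q by auto
      qed
      have "card (prod_set A') + card ((*) v ` A) \<le> card (prod_set A)"
      proof (rule new_le)
        show "(*) v ` A \<subseteq> prod_set A" using v by (auto simp: prod_set_def)
        have "v * a \<noteq> b * c" if "a \<in> A" "b \<in> A'" "c \<in> A'" for a b c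
          using irred[of a b c] big[OF Tv, of a b c] that AT by auto
        then show "(*) v ` A \<inter> prod_set A' = {}" unfolding prod_set_def by auto
      qed
      moreover have "card ((*) v ` A) = card A" using nz by (intro card_image inj_onI) auto
      \<comment> \<open>The dimension drops by one only: \<open>e\<close> coordinates for the rest
        and one more for \<open>v\<close> would determine \<open>A\<close>.\<close>
      moreover have "(e + 1) * card A' \<le> card (prod_set A') + e * (e + 1)"
      proof (rule less.hyps[OF smaller fin(1) A'0])
        fix R :: "int option set"
        assume R: "finite R" "None \<in> R" "card R \<le> e"
        show "\<not> determines R (val_vec ` A')"
        proof
          assume "determines R (val_vec ` A')"
          then obtain q where "determines (insert q R) (insert (val_vec v) (val_vec ` A'))"
            using determines_insert by blast
          then have "determines (insert q R) (val_vec ` A)"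
            by (rule determines_mono_span) (rule subset_trans[OF sub ratfun.span_superset])
          moreover have "card (insert q R) \<le> d" using R d by (simp add: card_insert_if)
          ultimately show False using less.prems(3) R by auto
        qed
      qed
      moreover have "(e + 2) * card A = (e + 1) * card A' + (e + 1) * card T + card A"
        using cardA by (simp add: algebra_simps)
      \<comment> \<open>The error grows by \<open>2 * (e + 1)\<close>, from
        \<open>e * (e + 1)\<close> to \<open>(e + 1) * (e + 2)\<close>; this is the place where
        \<open>T\<close> having at most two elements matters.\<close>
      moreover have "(e + 1) * card T \<le> (e + 1) * 2" using T2 by (intro mult_left_mono) auto
      ultimately show ?thesis unfolding d by (simp add: algebra_simps)
    next
      case False
      define I where "I = {i \<in> A'. \<forall>b\<in>A'. \<forall>c\<in>A'. \<bar>v * i\<bar> \<noteq> \<bar>b * c\<bar>}"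
      have span: "val_vec ` A' \<subseteq> ratfun.span (val_vec ` insert v I)"
        using irreducibles_span[OF fin(1) nz(1) A'0 A'lt I_def] .
      \<comment> \<open>One representative per absolute value rules out
        \<open>t * i = (- t) * (- i)\<close>, so that multiplication is injective on
        \<open>T \<times> J\<close>.\<close>
      obtain J where J: "J \<subseteq> insert v I" "inj_on abs J" "abs ` insert v I = abs ` J"
        using subset_image_inj[of "abs ` insert v I" abs "insert v I"] by auto
      have Inz: "0 \<notin> insert v I" using nz A'0 by (auto simp: I_def)
      have finJ: "finite J" using J(1) fin by (auto simp: I_def intro: finite_subset)
      have "J \<noteq> {}" using J(3) by auto
      have valJ: "val_vec ` insert v I = val_vec ` J"
      proof -
        have "val_vec i \<in> val_vec ` J" if i: "i \<in> insert v I" for i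
        proof -
          obtain j where j: "j \<in> J" "\<bar>i\<bar> = \<bar>j\<bar>" using i J(3) by (metis image_iff)
          have "i \<noteq> 0" "j \<noteq> 0" using i j(1) J(1) Inz by auto
          then have "val_vec i = val_vec j" using j by (intro val_vec_eqI)
          then show ?thesis using j by simp
        qed
        then show ?thesis using J(1) by auto
      qed
      have "\<exists>Q. finite Q \<and> None \<in> Q \<and> card Q \<le> card (val_vec ` J) \<and> determines Q (val_vec ` J)"
        using finJ \<open>J \<noteq> {}\<close> by (intro determining_set_exists) auto
      then obtain Q where Q: "finite Q" "None \<in> Q" "card Q \<le> card (val_vec ` J)"
          "determines Q (val_vec ` J)" by auto
      have "val_vec v \<in> ratfun.span (val_vec ` J)"
        unfolding valJ[symmetric] by (intro ratfun.span_base) simp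
      then have "insert (val_vec v) (val_vec ` A') \<subseteq> ratfun.span (val_vec ` J)"
        using span valJ by simp
      \<comment> \<open>Since the vectors of \<open>J\<close> span everything, the dimension
        hypothesis forces at least \<open>d + 1\<close> elements in \<open>J\<close>.\<close>
      then have "determines Q (val_vec ` A)"
        by (intro determines_mono_span[OF Q(4)] subset_trans[OF sub])
      then have "\<not> card Q \<le> d" using less.prems(3) Q by blast
      then have rJ: "d + 1 \<le> card J" using Q(3) card_image_le[OF finJ, of val_vec] by linarith
      define N where "N = (\<lambda>(t, i). t * i) ` (T \<times> J)"
      have JA: "J \<subseteq> A" using J(1) v(1) AT by (auto simp: I_def)
      have "inj_on (\<lambda>(t, i). t * i) (T \<times> J)"
      proof (rule inj_onI, clarify)
        fix t i s j
        assume *: "t \<in> T" "i \<in> J" "s \<in> T" "j \<in> J" "t * i = s * j"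
        then have "\<bar>t\<bar> * \<bar>i\<bar> = \<bar>s\<bar> * \<bar>j\<bar>" by (metis abs_mult)
        then have "\<bar>i\<bar> = \<bar>j\<bar>" using * nz by (simp add: T_def)
        then have "i = j" using * J(2) by (auto dest: inj_onD)
        moreover have "j \<noteq> 0" using * J(1) Inz by auto
        ultimately show "t = s \<and> i = j" using * by simp
      qed
      then have "card N = card T * card J" unfolding N_def by (simp add: card_image card_cartesian_product)
      moreover have "card (prod_set A') + card N \<le> card (prod_set A)"
      proof (rule new_le)
        show "N \<subseteq> prod_set A" using JA AT unfolding N_def prod_set_def by auto
        have "t * i \<noteq> b * c" if *: "t \<in> T" "i \<in> J" "b \<in> A'" "c \<in> A'" for t i b c
        proof
          assume "t * i = b * c"
          moreover have "\<bar>t * i\<bar> = \<bar>v * i\<bar>" using *(1) v by (simp add: abs_mult T_def)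
          ultimately have eq: "\<bar>v * i\<bar> = \<bar>b * c\<bar>" by simp
          consider "i = v" | "i \<in> I" using * J(1) by auto
          then show False
          proof cases
            case 1
            then show False using big[OF Tv Tv *(3,4)] eq by simp
          next
            case 2
            then show False using eq * by (auto simp: I_def)
          qed
        qed
        then show "N \<inter> prod_set A' = {}" unfolding N_def prod_set_def by auto
      qed
      moreover have "(d + 1) * card A' \<le> card (prod_set A') + d * (d + 1)"
        using False by (intro less.hyps[OF smaller fin(1) A'0]) auto
      moreover have "card T * (d + 1) \<le> card T * card J" using rJ by (rule mult_left_mono) auto
      ultimately show ?thesis unfolding cardA by (simp add: algebra_simps)
    qed
  qed
qed

section \<open>Coincidences and valuations\<close>

text \<open>Bernoulli's inequality for \<open>x / y\<close>, multiplied by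
  \<open>y ^ k\<close>.\<close>

lemma power_young:
  fixes x y :: real
  assumes "x \<ge> 0" "y \<ge> 0" "k \<ge> 1"
  shows "real k * (x * y ^ (k - 1)) \<le> x ^ k + (real k - 1) * y ^ k"
proof (cases "y = 0")
  case True
  then show ?thesis using assms by (cases "k = 1") (auto simp: power_0_left)
next
  case False
  then have y: "y > 0" using assms by simp
  have "1 + real k * (x / y - 1) \<le> (1 + (x / y - 1)) ^ k"
    using assms y by (intro Bernoulli_inequality) simp
  then have "(1 + real k * (x / y - 1)) * y ^ k \<le> (x / y) ^ k * y ^ k"
    using y by (intro mult_right_mono) auto
  also have "\<dots> = x ^ k" using y by (simp add: power_divide)
  also have "(1 + real k * (x / y - 1)) * y ^ k
      = real k * (x * y ^ (k - 1)) - (real k - 1) * y ^ k"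
    using y assms(3) by (cases k) (simp_all add: field_simps)
  finally show ?thesis by simp
qed

text \<open>Hoelder's inequality for the exponents \<open>k\<close> and \<open>k / (k - 1)\<close>:
  scale both families to \<open>k\<close>-norm 1 and sum Young's inequality.\<close>

lemma holder_power:
  fixes g h :: "'i \<Rightarrow> real"
  assumes "finite I" "\<And>i. i \<in> I \<Longrightarrow> g i \<ge> 0" "\<And>i. i \<in> I \<Longrightarrow> h i \<ge> 0" "k \<ge> 2"
  shows "(\<Sum>i\<in>I. g i * h i ^ (k - 1))
    \<le> root k (\<Sum>i\<in>I. g i ^ k) * root k (\<Sum>i\<in>I. h i ^ k) ^ (k - 1)"
proof -
  define a where "a = root k (\<Sum>i\<in>I. g i ^ k)"
  define b where "b = root k (\<Sum>i\<in>I. h i ^ k)"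
  have ge: "a \<ge> 0" "b \<ge> 0" unfolding a_def b_def using assms by (auto intro!: real_root_ge_zero sum_nonneg)
  have ak: "a ^ k = (\<Sum>i\<in>I. g i ^ k)" and bk: "b ^ k = (\<Sum>i\<in>I. h i ^ k)"
    unfolding a_def b_def using assms by (auto intro!: real_root_pow_pos2 sum_nonneg)
  show ?thesis
  proof (cases "a = 0 \<or> b = 0")
    case True
    then have "(\<forall>i\<in>I. g i = 0) \<or> (\<forall>i\<in>I. h i = 0)"
      using ak bk assms by (auto simp: sum_nonneg_eq_0_iff power_0_left)
    then have "(\<Sum>i\<in>I. g i * h i ^ (k - 1)) = 0" using assms by (auto simp: power_0_left)
    then show ?thesis using ge unfolding a_def b_def by simp
  next
    case False
    then have pos: "a > 0" "b > 0" using ge by auto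
    have "real k * ((\<Sum>i\<in>I. g i * h i ^ (k - 1)) / (a * b ^ (k - 1)))
        = (\<Sum>i\<in>I. real k * ((g i / a) * (h i / b) ^ (k - 1)))"
      by (simp add: sum_distrib_left sum_divide_distrib power_divide)
    also have "\<dots> \<le> (\<Sum>i\<in>I. (g i / a) ^ k + (real k - 1) * (h i / b) ^ k)"
      using assms pos by (intro sum_mono power_young) auto
    also have "\<dots> = (\<Sum>i\<in>I. g i ^ k) / a ^ k + (real k - 1) * ((\<Sum>i\<in>I. h i ^ k) / b ^ k)"
      by (simp add: sum.distrib sum_distrib_left sum_divide_distrib power_divide)
    also have "\<dots> = real k * 1" using pos by (simp add: ak[symmetric] bk[symmetric])
    finally have "(\<Sum>i\<in>I. g i * h i ^ (k - 1)) / (a * b ^ (k - 1)) \<le> 1"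
      using assms(4) by (subst (asm) mult_le_cancel_left_pos) auto
    then show ?thesis using pos unfolding a_def[symmetric] b_def[symmetric]
      by (simp add: divide_le_eq)
  qed
qed

text \<open>The bound in the hypothesis again contains \<open>h\<close>. With \<open>b\<close> its
  \<open>k\<close>-norm, Hoelder gives \<open>b ^ k \<le> c * s * b ^ (k - 1)\<close>, and
  \<open>b ^ (k - 1)\<close> cancels.\<close>

lemma root_sum_le_if_holder:
  fixes g :: "'j \<Rightarrow> 'i \<Rightarrow> real" and h :: "'i \<Rightarrow> real"
  assumes "finite I" "\<And>j i. j \<in> J \<Longrightarrow> i \<in> I \<Longrightarrow> g j i \<ge> 0" "\<And>i. i \<in> I \<Longrightarrow> h i \<ge> 0" "k \<ge> 2"
    and "c \<ge> 0" and le: "(\<Sum>i\<in>I. h i ^ k) \<le> c * (\<Sum>j\<in>J. \<Sum>i\<in>I. g j i * h i ^ (k - 1))"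
  shows "root k (\<Sum>i\<in>I. h i ^ k) \<le> c * (\<Sum>j\<in>J. root k (\<Sum>i\<in>I. g j i ^ k))"
proof -
  define b where "b = root k (\<Sum>i\<in>I. h i ^ k)"
  define s where "s = (\<Sum>j\<in>J. root k (\<Sum>i\<in>I. g j i ^ k))"
  have s: "s \<ge> 0" unfolding s_def using assms by (auto intro!: sum_nonneg real_root_ge_zero)
  have b: "b \<ge> 0" unfolding b_def using assms by (auto intro!: real_root_ge_zero sum_nonneg)
  have "b ^ k = (\<Sum>i\<in>I. h i ^ k)"
    unfolding b_def using assms by (auto intro!: real_root_pow_pos2 sum_nonneg)
  also have "\<dots> \<le> c * (\<Sum>j\<in>J. \<Sum>i\<in>I. g j i * h i ^ (k - 1))" by (rule le)
  also have "\<dots> \<le> c * (\<Sum>j\<in>J. root k (\<Sum>i\<in>I. g j i ^ k) * b ^ (k - 1))"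
    unfolding b_def using assms by (intro mult_left_mono sum_mono holder_power) auto
  also have "\<dots> = c * s * b ^ (k - 1)" unfolding s_def by (simp add: sum_distrib_right mult.assoc)
  finally have "b * b ^ (k - 1) \<le> c * s * b ^ (k - 1)"
    using assms(4) by (cases k) auto
  then have "b \<le> c * s" using b s \<open>c \<ge> 0\<close> by (cases "b = 0") auto
  then show ?thesis by (simp add: b_def s_def)
qed

section \<open>Coincidences between tuples and their p-adic constraints\<close>

text \<open>Both \<open>k\<close>-tuples sit in one function on \<open>{..<2*k}\<close>, so that two
  positions can be picked without saying on which side they lie.\<close>

definition solution :: "nat \<Rightarrow> (nat \<Rightarrow> rat) \<Rightarrow> bool" where
  "solution k g \<longleftrightarrow> (\<Prod>l<k. g l) = (\<Prod>l=k..<2*k. g l) \<and> (\<Prod>l<k. 1 + g l) = (\<Prod>l=k..<2*k. 1 + g l)"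

text \<open>The multiplicative energy of order \<open>k\<close> of the points
  \<open>(a, 1 + a)\<close>. Extensional functions represent each tuple once.\<close>

definition energy :: "nat \<Rightarrow> rat set \<Rightarrow> nat" where
  "energy k A = card {g \<in> {..<2*k} \<rightarrow>\<^sub>E A. solution k g}"

text \<open>Restores the convention that 0 has infinite valuation.\<close>

definition val_ge :: "int \<Rightarrow> int \<Rightarrow> rat \<Rightarrow> bool" where
  "val_ge p j x \<longleftrightarrow> x = 0 \<or> j \<le> vp p x"

lemma val_ge_add: "prime p \<Longrightarrow> val_ge p j x \<Longrightarrow> val_ge p j y \<Longrightarrow> val_ge p j (x + y)"
  using vp_add_ge[of p x y j]
  by (cases "x = 0"; cases "y = 0"; cases "x + y = 0") (simp_all add: val_ge_def)

lemma val_ge_uminus: "prime p \<Longrightarrow> val_ge p j x \<Longrightarrow> val_ge p j (- x)"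
  by (cases "x = 0") (simp_all add: val_ge_def vp_uminus)

lemma val_ge_mult: "prime p \<Longrightarrow> val_ge p i x \<Longrightarrow> val_ge p j y \<Longrightarrow> 0 \<le> i \<Longrightarrow> val_ge p j (x * y)"
  by (cases "x = 0"; cases "y = 0") (simp_all add: val_ge_def vp_mult)

text \<open>Congruence to 1 modulo \<open>p ^ j\<close> is preserved by products, since
  \<open>(1 + y) * P - 1 = (P - 1) + y + y * (P - 1)\<close>.\<close>

lemma val_ge_prod_minus_one:
  assumes "prime p" "j \<ge> 0" "finite L" "\<And>l. l \<in> L \<Longrightarrow> val_ge p j (y l)"
  shows "val_ge p j ((\<Prod>l\<in>L. 1 + y l) - 1)"
  using assms(3,4)
proof (induction L rule: finite_induct)
  case empty
  then show ?case by (simp add: val_ge_def)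
next
  case (insert l L)
  define P where "P = (\<Prod>l\<in>L. 1 + y l)"
  have "val_ge p j (P - 1)" "val_ge p j (y l)" using insert by (auto simp: P_def)
  then have "val_ge p j ((P - 1) + y l + y l * (P - 1))"
    using assms(1,2) by (intro val_ge_add val_ge_mult[of p j]) auto
  also have "(P - 1) + y l + y l * (P - 1) = (1 + y l) * P - 1" by (simp add: algebra_simps)
  finally show ?case using insert by (simp add: P_def)
qed

text \<open>Modulo the power of \<open>p\<close> one above the valuation of \<open>g l0\<close>, all
  factors except \<open>1 + g l0\<close> are 1. Equal products would force \<open>g l0\<close> to
  vanish to that higher order.\<close>

lemma unique_min_valuation_imp_neq:
  assumes "prime p" "finite L" "finite R" "l0 \<in> L" "g l0 \<noteq> 0" "vp p (g l0) \<ge> 0"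
    and "\<And>l. l \<in> L \<union> R - {l0} \<Longrightarrow> vp p (g l) > vp p (g l0)" "l0 \<notin> R"
  shows "(\<Prod>l\<in>L. 1 + g l) \<noteq> (\<Prod>l\<in>R. 1 + g l)"
proof
  assume eq: "(\<Prod>l\<in>L. 1 + g l) = (\<Prod>l\<in>R. 1 + g l)"
  define j where "j = vp p (g l0) + 1"
  define Q where "Q = (\<Prod>l\<in>L - {l0}. 1 + g l)"
  define S where "S = (\<Prod>l\<in>R. 1 + g l)"
  have j: "j \<ge> 0" using assms(6) by (simp add: j_def)
  have v: "val_ge p j (g l)" if "l \<in> L \<union> R - {l0}" for l
    using assms(7)[OF that] by (simp add: j_def val_ge_def)
  have Q: "val_ge p j (Q - 1)"
    unfolding Q_def using assms(1,2) j v by (intro val_ge_prod_minus_one) auto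
  have S: "val_ge p j (S - 1)"
    unfolding S_def using assms(1,3,8) j v by (intro val_ge_prod_minus_one) auto
  have "S = (1 + g l0) * Q"
    unfolding Q_def S_def eq[symmetric] using assms(2,4) by (rule prod.remove)
  then have "g l0 = (S - 1) + (- (Q - 1) + - (g l0 * (Q - 1)))"
    by (simp only:) (simp add: algebra_simps)
  moreover have "val_ge p j ((S - 1) + (- (Q - 1) + - (g l0 * (Q - 1))))"
  proof -
    have "val_ge p j (g l0 * (Q - 1))"
      using assms(1,6) Q by (intro val_ge_mult[of p "vp p (g l0)"]) (auto simp: val_ge_def)
    then show ?thesis using assms(1) Q S by (intro val_ge_add val_ge_uminus)
  qed
  ultimately have "val_ge p j (g l0)" by simp
  then show False using assms(5) by (simp add: val_ge_def j_def)
qed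

text \<open>If all valuations differed, the least would occur once, on one of the two sides, and the
  products of the \<open>1 + g l\<close> could not agree.\<close>

lemma solution_valuation_collision_nonneg:
  assumes "solution k g" "k \<ge> 1" "prime p"
    and g: "\<And>l. l < 2 * k \<Longrightarrow> g l \<noteq> 0" "\<And>l. l < 2 * k \<Longrightarrow> vp p (g l) \<ge> 0"
  shows "\<exists>l1 l2. l1 < 2 * k \<and> l2 < 2 * k \<and> l1 \<noteq> l2 \<and> vp p (g l1) = vp p (g l2)"
proof (rule ccontr)
  assume no: "\<not> ?thesis"
  obtain l0 where l0: "l0 < 2 * k" "\<And>l. l < 2 * k \<Longrightarrow> vp p (g l0) \<le> vp p (g l)"
  proof -
    have "finite {..<2*k}" "{..<2*k} \<noteq> {}" using assms(2) by (auto simp: lessThan_empty_iff)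
    from ex_is_arg_min_if_finite[OF this, of "\<lambda>l. vp p (g l)"] show thesis
      using that unfolding is_arg_min_linorder by auto
  qed
  have gt: "vp p (g l) > vp p (g l0)" if "l < 2 * k" "l \<noteq> l0" for l
  proof -
    have "vp p (g l) \<noteq> vp p (g l0)" using no that l0(1) by blast
    then show ?thesis using l0(2)[OF that(1)] by simp
  qed
  show False
  proof (cases "l0 < k")
    case True
    have "(\<Prod>l\<in>{..<k}. 1 + g l) \<noteq> (\<Prod>l\<in>{k..<2*k}. 1 + g l)"
      by (rule unique_min_valuation_imp_neq[OF assms(3), of _ _ l0]) (use True gt g l0 in auto)
    then show False using assms(1) by (simp add: solution_def)
  next
    case False
    have "(\<Prod>l\<in>{k..<2*k}. 1 + g l) \<noteq> (\<Prod>l\<in>{..<k}. 1 + g l)"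
      by (rule unique_min_valuation_imp_neq[OF assms(3), of _ _ l0]) (use False gt g l0 in auto)
    then show False using assms(1) by (simp add: solution_def)
  qed
qed

text \<open>As \<open>1 + 1 / g = (1 + g) / g\<close>, the second equation for the inverses is the
  quotient of the two given ones. This is the reason for recording the plain products along with the
  shifted ones.\<close>

lemma solution_inverse:
  assumes "solution k g" "\<And>l. l < 2 * k \<Longrightarrow> g l \<noteq> 0"
  shows "solution k (\<lambda>l. inverse (g l))"
proof -
  have inv: "(\<Prod>l\<in>L. inverse (g l)) = inverse (\<Prod>l\<in>L. g l)" for L
    using prod_inversef[of g L] by (simp add: o_def)
  have "(\<Prod>l\<in>L. 1 + inverse (g l)) = (\<Prod>l\<in>L. 1 + g l) * inverse (\<Prod>l\<in>L. g l)"
    if "L \<subseteq> {..<2*k}" for L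
  proof -
    have "(\<Prod>l\<in>L. 1 + inverse (g l)) = (\<Prod>l\<in>L. (1 + g l) * inverse (g l))"
      using that assms(2) by (intro prod.cong refl) (auto simp: field_simps)
    then show ?thesis using inv by (simp add: prod.distrib)
  qed
  from this[of "{..<k}"] this[of "{k..<2*k}"] show ?thesis
    using assms(1) unfolding solution_def by (auto simp: inv subset_iff)
qed

lemma solution_valuation_collision_neg:
  assumes "solution k g" "k \<ge> 1" "prime p"
    and g: "\<And>l. l < 2 * k \<Longrightarrow> g l \<noteq> 0" "\<And>l. l < 2 * k \<Longrightarrow> vp p (g l) < 0"
  shows "\<exists>l1 l2. l1 < 2 * k \<and> l2 < 2 * k \<and> l1 \<noteq> l2 \<and> vp p (g l1) = vp p (g l2)"
proof -
  have "\<exists>l1 l2. l1 < 2 * k \<and> l2 < 2 * k \<and> l1 \<noteq> l2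
      \<and> vp p (inverse (g l1)) = vp p (inverse (g l2))"
    using assms by (intro solution_valuation_collision_nonneg solution_inverse)
      (auto simp: vp_inverse less_imp_le)
  then obtain l1 l2 where l: "l1 < 2 * k" "l2 < 2 * k" "l1 \<noteq> l2"
      "vp p (inverse (g l1)) = vp p (inverse (g l2))" by blast
  then have "vp p (g l1) = vp p (g l2)" using g(1) assms(3) by (simp add: vp_inverse)
  then show ?thesis using l by blast
qed

section \<open>Characters and energy\<close>

text \<open>Unitary characters of the group of pairs of nonzero rationals, as total functions with
  arbitrary values at the other pairs.\<close>

definition pair_character :: "(rat \<times> rat \<Rightarrow> complex) \<Rightarrow> bool" where
  "pair_character \<psi> \<longleftrightarrow>
    (\<forall>x y x' y'. x \<noteq> 0 \<longrightarrow> y \<noteq> 0 \<longrightarrow> x' \<noteq> 0 \<longrightarrow> y' \<noteq> 0 \<longrightarrow> \<psi> (x * x', y * y') = \<psi> (x, y) * \<psi> (x', y')) \<and>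
    (\<forall>x y. x \<noteq> 0 \<longrightarrow> y \<noteq> 0 \<longrightarrow> norm (\<psi> (x, y)) = 1)"

lemma pair_character_one:
  assumes "pair_character \<psi>"
  shows "\<psi> (1, 1) = 1"
proof -
  have "\<psi> (1 * 1, 1 * 1) = \<psi> (1, 1) * \<psi> (1, 1)" "norm (\<psi> (1, 1)) = 1"
    using assms unfolding pair_character_def by (metis one_neq_zero)+
  then show ?thesis by auto
qed

lemma pair_character_inverse:
  assumes "pair_character \<psi>" "x \<noteq> 0" "y \<noteq> 0"
  shows "\<psi> (inverse x, inverse y) = cnj (\<psi> (x, y))"
proof -
  have "\<psi> (x * inverse x, y * inverse y) = \<psi> (x, y) * \<psi> (inverse x, inverse y)"
    using assms unfolding pair_character_def by (metis inverse_nonzero_iff_nonzero)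
  then have 1: "\<psi> (x, y) * \<psi> (inverse x, inverse y) = 1"
    using assms(2,3) pair_character_one[OF assms(1)] by simp
  have n: "norm (\<psi> (x, y)) = 1" using assms unfolding pair_character_def by blast
  then have 2: "\<psi> (x, y) * cnj (\<psi> (x, y)) = 1" by (simp add: complex_norm_square[symmetric])
  have "\<psi> (x, y) \<noteq> 0" using n by auto
  then show ?thesis using 1 2 by (metis mult_left_cancel)
qed

lemma pair_character_prod:
  assumes "pair_character \<psi>" "finite L" "\<And>l. l \<in> L \<Longrightarrow> x l \<noteq> 0" "\<And>l. l \<in> L \<Longrightarrow> y l \<noteq> 0"
  shows "\<psi> (\<Prod>l\<in>L. x l, \<Prod>l\<in>L. y l) = (\<Prod>l\<in>L. \<psi> (x l, y l))"
  using assms(2,3,4)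
proof (induction L rule: finite_induct)
  case empty
  then show ?case using assms(1) by (simp add: pair_character_one)
next
  case (insert l L)
  then have "\<psi> (x l * (\<Prod>l\<in>L. x l), y l * (\<Prod>l\<in>L. y l)) = \<psi> (x l, y l) * \<psi> (\<Prod>l\<in>L. x l, \<Prod>l\<in>L. y l)"
    using assms(1) unfolding pair_character_def by auto
  then show ?case using insert by simp
qed

lemma pair_character_mult_family:
  assumes "\<And>z. z \<in> S \<Longrightarrow> pair_character (\<psi> z)"
  shows "pair_character (\<lambda>w. \<Prod>z\<in>S. \<psi> z w)"
  unfolding pair_character_def
proof (intro conjI allI impI)
  fix x y x' y' :: rat
  assume nz: "x \<noteq> 0" "y \<noteq> 0" "x' \<noteq> 0" "y' \<noteq> 0"
  have "\<psi> z (x * x', y * y') = \<psi> z (x, y) * \<psi> z (x', y')" if "z \<in> S" for z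
    using assms[OF that] nz unfolding pair_character_def by blast
  then have "(\<Prod>z\<in>S. \<psi> z (x * x', y * y')) = (\<Prod>z\<in>S. \<psi> z (x, y) * \<psi> z (x', y'))"
    by (intro prod.cong) auto
  then show "(\<Prod>z\<in>S. \<psi> z (x * x', y * y')) = (\<Prod>z\<in>S. \<psi> z (x, y)) * (\<Prod>z\<in>S. \<psi> z (x', y'))"
    by (simp add: prod.distrib)
next
  fix x y :: rat
  assume nz: "x \<noteq> 0" "y \<noteq> 0"
  have "norm (\<psi> z (x, y)) = 1" if "z \<in> S" for z
    using assms[OF that] nz unfolding pair_character_def by blast
  then show "norm (\<Prod>z\<in>S. \<psi> z (x, y)) = 1" by (simp add: prod_norm[symmetric])
qed

text \<open>For \<open>x = -1\<close> the sign serves. Otherwise some prime has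
  \<open>vp p x \<noteq> 0\<close>, and \<open>a\<close> is sent to the angle
  \<open>pi * vp p a / vp p x\<close>. The value \<open>-1\<close> is wanted because it annihilates
  a factor \<open>\<psi> + 1\<close>.\<close>

lemma separating_rat_character:
  fixes x :: rat
  assumes "x \<noteq> 0" "x \<noteq> 1"
  shows "\<exists>\<phi>::rat \<Rightarrow> complex. (\<forall>a b. a \<noteq> 0 \<longrightarrow> b \<noteq> 0 \<longrightarrow> \<phi> (a * b) = \<phi> a * \<phi> b) \<and>
    (\<forall>a. a \<noteq> 0 \<longrightarrow> norm (\<phi> a) = 1) \<and> \<phi> x = -1"
proof (cases "\<bar>x\<bar> = 1")
  case True
  then have x: "x = -1" using assms by (auto simp: abs_if split: if_splits)
  define \<phi> :: "rat \<Rightarrow> complex" where "\<phi> a = (if a < 0 then -1 else 1)" for a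
  have "\<phi> (a * b) = \<phi> a * \<phi> b" if "a \<noteq> 0" "b \<noteq> 0" for a b
    using that by (auto simp: \<phi>_def mult_less_0_iff)
  moreover have "norm (\<phi> a) = 1" for a by (simp add: \<phi>_def)
  ultimately show ?thesis using x by (intro exI[of _ \<phi>]) (auto simp: \<phi>_def)
next
  case False
  then obtain p where p: "prime p" "vp p x \<noteq> 0" using abs_eq_one_if_vp_zero assms by blast
  define \<phi> where "\<phi> a = cis (pi * of_int (vp p a) / of_int (vp p x))" for a
  have "\<phi> (a * b) = \<phi> a * \<phi> b" if "a \<noteq> 0" "b \<noteq> 0" for a b
    using that p by (simp add: \<phi>_def vp_mult cis_mult ring_distribs add_divide_distrib)
  moreover have "norm (\<phi> a) = 1" for a by (simp add: \<phi>_def)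
  moreover have "\<phi> x = -1" using p by (simp add: \<phi>_def)
  ultimately show ?thesis by (intro exI[of _ \<phi>]) auto
qed

lemma separating_pair_character:
  assumes "fst z \<noteq> 0" "snd z \<noteq> 0" "z \<noteq> (1, 1)"
  shows "\<exists>\<psi>. pair_character \<psi> \<and> \<psi> z = -1"
proof (cases "fst z = 1")
  case False
  then obtain \<phi> :: "rat \<Rightarrow> complex" where "\<forall>a b. a \<noteq> 0 \<longrightarrow> b \<noteq> 0 \<longrightarrow> \<phi> (a * b) = \<phi> a * \<phi> b"
      "\<forall>a. a \<noteq> 0 \<longrightarrow> norm (\<phi> a) = 1" "\<phi> (fst z) = -1"
    using separating_rat_character[of "fst z"] assms by blast
  then show ?thesis by (intro exI[of _ "\<lambda>w. \<phi> (fst w)"]) (auto simp: pair_character_def)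
next
  case True
  then have "snd z \<noteq> 1" using assms by (metis prod.collapse)
  then obtain \<phi> :: "rat \<Rightarrow> complex" where "\<forall>a b. a \<noteq> 0 \<longrightarrow> b \<noteq> 0 \<longrightarrow> \<phi> (a * b) = \<phi> a * \<phi> b"
      "\<forall>a. a \<noteq> 0 \<longrightarrow> norm (\<phi> a) = 1" "\<phi> (snd z) = -1"
    using separating_rat_character[of "snd z"] assms by blast
  then show ?thesis by (intro exI[of _ "\<lambda>w. \<phi> (snd w)"]) (auto simp: pair_character_def)
qed

text \<open>A finite substitute for Fourier analysis: if \<open>\<psi>\<^sub>z z = -1\<close>, then the sum over all
  products of the \<open>\<psi>\<^sub>z\<close> equals \<open>\<Prod>\<^sub>z (\<psi>\<^sub>z + 1)\<close>, which vanishes on \<open>Z\<close>.\<close>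

lemma orthogonal_characters:
  fixes Z :: "(rat \<times> rat) set"
  assumes "finite Z" "\<And>z. z \<in> Z \<Longrightarrow> fst z \<noteq> 0 \<and> snd z \<noteq> 0 \<and> z \<noteq> (1, 1)"
  shows "\<exists>(I :: (rat \<times> rat) set set) X. finite I \<and> I \<noteq> {} \<and> (\<forall>S\<in>I. pair_character (X S)) \<and>
    (\<forall>z\<in>Z. (\<Sum>S\<in>I. X S z) = 0)"
proof -
  have "\<forall>z\<in>Z. \<exists>\<psi>. pair_character \<psi> \<and> \<psi> z = -1" using separating_pair_character assms(2) by blast
  then obtain \<psi> where \<psi>: "\<forall>z\<in>Z. pair_character (\<psi> z) \<and> \<psi> z z = -1" by metis
  define X where "X S w = (\<Prod>z\<in>S. \<psi> z w)" for S w
  have "pair_character (X S)" if "S \<in> Pow Z" for S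
    using pair_character_mult_family[of S \<psi>] \<psi> that unfolding X_def by blast
  moreover have "(\<Sum>S\<in>Pow Z. X S w) = 0" if "w \<in> Z" for w
  proof -
    have "(\<Sum>S\<in>Pow Z. X S w) = (\<Prod>z\<in>Z. \<psi> z w + 1)"
      by (simp add: prod_add[OF assms(1)] X_def)
    also have "\<dots> = 0" using that \<psi> assms(1) by (intro prod_zero) (auto intro!: bexI[of _ w])
    finally show ?thesis .
  qed
  ultimately show ?thesis using assms(1) by (intro exI[of _ "Pow Z"] exI[of _ X]) auto
qed

section \<open>Counting solutions by character sums\<close>

text \<open>A tuple is a solution iff the quotient of left by right products is 1 in both
  components. Orthogonal characters detect this and factor over the positions, so the sum over a box
  becomes a product. One choice of \<open>I\<close> and \<open>x\<close> serves all boxes in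
  \<open>A\<close>, which makes energies of subsets comparable.\<close>

lemma solutions_character_sum:
  assumes "finite A" "0 \<notin> A" "-1 \<notin> A"
  shows "\<exists>(I :: (rat \<times> rat) set set) (x :: _ \<Rightarrow> rat \<Rightarrow> complex). finite I \<and> I \<noteq> {} \<and>
    (\<forall>Y. (\<forall>l<2*k. Y l \<subseteq> A) \<longrightarrow>
      of_nat (card I * card {g \<in> PiE {..<2*k} Y. solution k g})
      = (\<Sum>S\<in>I. \<Prod>l<2*k. if l < k then sum (x S) (Y l) else cnj (sum (x S) (Y l))))"
proof -
  define G where "G = {..<2*k} \<rightarrow>\<^sub>E A"
  have finG: "finite G" unfolding G_def using assms by (intro finite_PiE) auto
  have nz: "g l \<noteq> 0" "1 + g l \<noteq> 0" if "g \<in> G" "l < 2*k" for g l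
  proof -
    have "g l \<in> A" using that by (auto simp: G_def)
    then show "g l \<noteq> 0" "1 + g l \<noteq> 0"
      using assms by (auto simp: add_eq_0_iff)
  qed
  define q :: "(nat \<Rightarrow> rat) \<Rightarrow> rat" where "q h = (\<Prod>l<k. h l) * (\<Prod>l=k..<2*k. inverse (h l))" for h
  have q_one: "q h = 1 \<longleftrightarrow> (\<Prod>l<k. h l) = (\<Prod>l=k..<2*k. h l)" and q_nz: "q h \<noteq> 0"
    if "\<And>l. l < 2*k \<Longrightarrow> h l \<noteq> 0" for h
  proof -
    have "(\<Prod>l=k..<2*k. inverse (h l)) = inverse (\<Prod>l=k..<2*k. h l)"
      using prod_inversef[of h "{k..<2*k}"] by (simp add: o_def)
    moreover have "(\<Prod>l=k..<2*k. h l) \<noteq> 0" "(\<Prod>l<k. h l) \<noteq> 0" using that by auto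
    moreover have "a * inverse b = 1 \<longleftrightarrow> a = b" "a * inverse b \<noteq> 0" if "a \<noteq> 0" "b \<noteq> 0" for a b :: rat
      using that by (auto simp: field_simps)
    ultimately show "q h = 1 \<longleftrightarrow> (\<Prod>l<k. h l) = (\<Prod>l=k..<2*k. h l)" "q h \<noteq> 0"
      unfolding q_def by presburger+
  qed
  define z where "z g = (q g, q (\<lambda>l. 1 + g l))" for g
  have z_sol: "z g = (1, 1) \<longleftrightarrow> solution k g" and z_nz: "fst (z g) \<noteq> 0" "snd (z g) \<noteq> 0"
    if "g \<in> G" for g
    using q_one[of g] q_one[of "\<lambda>l. 1 + g l"] q_nz[of g] q_nz[of "\<lambda>l. 1 + g l"] nz[OF that]
    by (auto simp: z_def solution_def)
  \<comment> \<open>Only the finitely many quotient pairs of non-solutions have to be annihilated,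
    and none of them is \<open>(1, 1)\<close>.\<close>
  define Z where "Z = z ` {g \<in> G. \<not> solution k g}"
  have "\<exists>(I :: (rat \<times> rat) set set) X. finite I \<and> I \<noteq> {} \<and> (\<forall>S\<in>I. pair_character (X S)) \<and>
      (\<forall>z\<in>Z. (\<Sum>S\<in>I. X S z) = 0)"
  proof (rule orthogonal_characters)
    show "finite Z" using finG by (simp add: Z_def)
    fix w assume "w \<in> Z"
    then obtain g where "g \<in> G" "\<not> solution k g" "w = z g" by (auto simp: Z_def)
    then show "fst w \<noteq> 0 \<and> snd w \<noteq> 0 \<and> w \<noteq> (1, 1)" using z_sol[of g] z_nz[of g] by simp
  qed
  then obtain I :: "(rat \<times> rat) set set" and X where I: "finite I" "I \<noteq> {}"
      and char: "\<And>S. S \<in> I \<Longrightarrow> pair_character (X S)" and orth: "\<And>w. w \<in> Z \<Longrightarrow> (\<Sum>S\<in>I. X S w) = 0"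
    by blast
  define x where "x S a = X S (a, 1 + a)" for S a
  define c where "c S l a = (if l < k then x S a else cnj (x S a))" for S l a
  \<comment> \<open>The inverses in the right half turn into conjugates, because characters have
    modulus 1.\<close>
  have Xz: "X S (z g) = (\<Prod>l<2*k. c S l (g l))" if S: "S \<in> I" and g: "g \<in> G" for S g
  proof -
    have "q h = (\<Prod>l<2*k. if l < k then h l else inverse (h l))" for h
    proof -
      have "{..<2*k} = {..<k} \<union> {k..<2*k}" by auto
      moreover have "(\<Prod>l\<in>{..<k} \<union> {k..<2*k}. if l < k then h l else inverse (h l))
        = (\<Prod>l<k. if l < k then h l else inverse (h l)) * (\<Prod>l=k..<2*k. if l < k then h l else inverse (h l))"
        by (intro prod.union_disjoint) auto
      ultimately show ?thesis unfolding q_def by (auto intro!: arg_cong2[where f = "(*)"] prod.cong)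
    qed
    then have "X S (z g) = X S (\<Prod>l<2*k. if l < k then g l else inverse (g l),
        \<Prod>l<2*k. if l < k then 1 + g l else inverse (1 + g l))"
      by (simp add: z_def)
    also have "\<dots> = (\<Prod>l<2*k. X S (if l < k then g l else inverse (g l),
        if l < k then 1 + g l else inverse (1 + g l)))"
      using nz[OF g] by (intro pair_character_prod char S) auto
    also have "\<dots> = (\<Prod>l<2*k. c S l (g l))"
      using nz[OF g] pair_character_inverse[OF char[OF S]]
      by (intro prod.cong refl) (auto simp: c_def x_def)
    finally show ?thesis .
  qed
  have ind: "(\<Sum>S\<in>I. \<Prod>l<2*k. c S l (g l)) = (if solution k g then of_nat (card I) else 0)"
    if g: "g \<in> G" for g
  proof -
    have "(\<Sum>S\<in>I. \<Prod>l<2*k. c S l (g l)) = (\<Sum>S\<in>I. X S (z g))" using Xz[OF _ g] by simp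
    also have "\<dots> = (if solution k g then of_nat (card I) else 0)"
    proof (cases "solution k g")
      case True
      then have "z g = (1, 1)" using z_sol[OF g] by simp
      then show ?thesis using True pair_character_one[OF char] by simp
    next
      case False
      then show ?thesis using orth[of "z g"] g by (auto simp: Z_def)
    qed
    finally show ?thesis .
  qed
  have "of_nat (card I * card {g \<in> PiE {..<2*k} Y. solution k g})
      = (\<Sum>S\<in>I. \<Prod>l<2*k. if l < k then sum (x S) (Y l) else cnj (sum (x S) (Y l)))"
    if Y: "\<forall>l<2*k. Y l \<subseteq> A" for Y
  proof -
    have sub: "PiE {..<2*k} Y \<subseteq> G" unfolding G_def using Y by (intro PiE_mono) auto
    have finY: "finite (Y l)" if "l < 2*k" for l using Y that assms(1) finite_subset by blast
    have finP: "finite (PiE {..<2*k} Y)" using sub finG by (rule finite_subset)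
    have "(\<Sum>S\<in>I. \<Prod>l<2*k. if l < k then sum (x S) (Y l) else cnj (sum (x S) (Y l)))
        = (\<Sum>S\<in>I. \<Prod>l<2*k. \<Sum>a\<in>Y l. c S l a)"
      by (intro sum.cong prod.cong refl) (simp add: c_def)
    also have "\<dots> = (\<Sum>S\<in>I. \<Sum>g\<in>PiE {..<2*k} Y. \<Prod>l<2*k. c S l (g l))"
      using finY by (intro sum.cong refl prod_sum_PiE) auto
    also have "\<dots> = (\<Sum>g\<in>PiE {..<2*k} Y. \<Sum>S\<in>I. \<Prod>l<2*k. c S l (g l))" by (rule sum.swap)
    also have "\<dots> = (\<Sum>g\<in>PiE {..<2*k} Y. if solution k g then of_nat (card I) else 0)"
      using sub by (intro sum.cong refl ind) auto
    also have "\<dots> = of_nat (card I * card {g \<in> PiE {..<2*k} Y. solution k g})"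
      using finP by (simp add: sum.If_cases Int_def)
    finally show ?thesis by simp
  qed
  then show ?thesis using I by (intro exI[of _ I] exI[of _ x]) auto
qed

lemma norm_prod_if_cnj:
  fixes f :: "'l \<Rightarrow> complex"
  shows "norm (\<Prod>l\<in>L. if P l then f l else cnj (f l)) = (\<Prod>l\<in>L. norm (f l))"
  by (simp add: prod_norm[symmetric] if_distrib cong: if_cong)

lemma prod_power_cnj:
  "(\<Prod>l<2*k. if l < k then z else cnj z) = of_real ((norm z ^ 2) ^ k)"
proof -
  have "{..<2*k} \<inter> {l. l < k} = {..<k}" "{..<2*k} \<inter> - {l. l < k} = {k..<2*k}" by auto
  then have "(\<Prod>l<2*k. if l < k then z else cnj z) = z ^ k * cnj z ^ k"
    by (simp add: prod.If_cases)
  also have "\<dots> = (of_real (norm z ^ 2)) ^ k"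
    by (simp only: complex_norm_square power_mult_distrib)
  finally show ?thesis by simp
qed

text \<open>For a box with equal sides the two conjugate halves combine: the energy is a moment of
  order \<open>2 * k\<close> of the character sum over \<open>B\<close>.\<close>

lemma energy_eq_norm_sum:
  assumes I: "finite I"
    and count: "\<And>Y. (\<forall>l<2*k. Y l \<subseteq> A) \<Longrightarrow>
      of_nat (card I * card {g \<in> PiE {..<2*k} Y. solution k g})
      = (\<Sum>S\<in>I. \<Prod>l<2*k. if l < k then sum (x S) (Y l) else cnj (sum (x S) (Y l)))"
    and "B \<subseteq> A"
  shows "real (card I * energy k B) = (\<Sum>S\<in>I. (norm (sum (x S) B) ^ 2) ^ k)"
proof -
  have "complex_of_real (real (card I * energy k B))
      = (\<Sum>S\<in>I. \<Prod>l<2*k. if l < k then sum (x S) B else cnj (sum (x S) B))"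
    using count[of "\<lambda>_. B"] assms(3) by (simp add: energy_def)
  also have "\<dots> = of_real (\<Sum>S\<in>I. (norm (sum (x S) B) ^ 2) ^ k)"
    unfolding prod_power_cnj by simp
  finally show ?thesis by (simp only: of_real_eq_iff)
qed

section \<open>Splitting the energy into classes\<close>

text \<open>Every solution lies in a box that confines some two positions to a common class of
  \<open>h\<close>. There are \<open>(2*k) choose 2\<close> choices of positions; character sums
  bound each box by a mixed moment, and Hoelder's inequality separates the class from
  \<open>A\<close>.\<close>

lemma root_energy_split:
  fixes h :: "rat \<Rightarrow> int"
  assumes A: "finite A" "0 \<notin> A" "-1 \<notin> A" and k: "k \<ge> 2"
    and coll: "\<And>g. solution k g \<Longrightarrow> (\<And>l. l < 2*k \<Longrightarrow> g l \<in> A) \<Longrightarrow>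
      \<exists>l1 l2. l1 < 2*k \<and> l2 < 2*k \<and> l1 \<noteq> l2 \<and> h (g l1) = h (g l2)"
  shows "root k (energy k A)
    \<le> real ((2*k) choose 2) * (\<Sum>j\<in>h ` A. root k (energy k {a \<in> A. h a = j}))"
proof -
  obtain I :: "(rat \<times> rat) set set" and x where I: "finite I" "I \<noteq> {}"
    and count: "\<And>Y. (\<forall>l<2*k. Y l \<subseteq> A) \<Longrightarrow>
      of_nat (card I * card {g \<in> PiE {..<2*k} Y. solution k g})
      = (\<Sum>S\<in>I. \<Prod>l<2*k. if l < k then sum (x S) (Y l) else cnj (sum (x S) (Y l)))"
    using solutions_character_sum[OF A, of k] by blast
  define F where "F B S = norm (sum (x S) B) ^ 2" for B S
  define c where "c j = {a \<in> A. h a = j}" for j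
  define N where "N = real (card I)"
  have N: "N > 0" using I by (simp add: N_def card_gt_0_iff)
  have en: "N * energy k B = (\<Sum>S\<in>I. F B S ^ k)" if "B \<subseteq> A" for B
    using energy_eq_norm_sum[OF I(1) count that] by (simp add: N_def F_def)
  define D where "D = {T. T \<subseteq> {..<2*k} \<and> card T = 2}"
  have finD: "finite D" unfolding D_def by (rule finite_subset[of _ "Pow {..<2*k}"]) auto
  have cardD: "card D = (2*k) choose 2" unfolding D_def using n_subsets[of "{..<2*k}" 2] by simp
  define Y where "Y T j l = (if l \<in> T then c j else A)" for T j and l :: nat
  define G where "G T j = {g \<in> PiE {..<2*k} (Y T j). solution k g}" for T and j :: int
  have YA: "Y T j l \<subseteq> A" for T j l by (auto simp: Y_def c_def)
  have finG: "finite (G T j)" for T j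
  proof -
    have "finite (PiE {..<2*k} (Y T j))"
      using YA finite_subset[OF YA A(1)] by (intro finite_PiE) auto
    then show ?thesis by (simp add: G_def)
  qed
  have "{g \<in> {..<2*k} \<rightarrow>\<^sub>E A. solution k g} \<subseteq> (\<Union>j\<in>h ` A. \<Union>T\<in>D. G T j)"
  proof
    fix g assume g: "g \<in> {g \<in> {..<2*k} \<rightarrow>\<^sub>E A. solution k g}"
    then have gA: "g l \<in> A" if "l < 2*k" for l using that by auto
    obtain l1 l2 where l: "l1 < 2*k" "l2 < 2*k" "l1 \<noteq> l2" "h (g l1) = h (g l2)"
      using coll[of g] g gA by auto
    have "{l1, l2} \<in> D" using l by (auto simp: D_def)
    moreover have "g \<in> G {l1, l2} (h (g l1))"
      using g l gA by (auto simp: G_def Y_def c_def PiE_iff)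
    moreover have "h (g l1) \<in> h ` A" using gA l by auto
    ultimately show "g \<in> (\<Union>j\<in>h ` A. \<Union>T\<in>D. G T j)" by blast
  qed
  then have "energy k A \<le> card (\<Union>j\<in>h ` A. \<Union>T\<in>D. G T j)"
    unfolding energy_def using finD finG A(1) by (intro card_mono) auto
  also have "\<dots> \<le> (\<Sum>j\<in>h ` A. card (\<Union>T\<in>D. G T j))" using A(1) by (intro card_UN_le) auto
  also have "\<dots> \<le> (\<Sum>j\<in>h ` A. \<Sum>T\<in>D. card (G T j))" using finD by (intro sum_mono card_UN_le)
  finally have "real (energy k A) \<le> real (\<Sum>j\<in>h ` A. \<Sum>T\<in>D. card (G T j))"
    by (simp only: of_nat_le_iff)
  then have e1: "real (energy k A) \<le> (\<Sum>j\<in>h ` A. \<Sum>T\<in>D. real (card (G T j)))" by simp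
  have e2: "N * card (G T j) \<le> (\<Sum>S\<in>I. F (c j) S * F A S ^ (k - 1))" if T: "T \<in> D" for T j
  proof -
    have finT: "finite T" "card T = 2" "T \<subseteq> {..<2*k}" using T by (auto simp: D_def intro: finite_subset)
    have "N * card (G T j) = norm (of_nat (card I * card (G T j)) :: complex)"
      by (simp add: N_def norm_mult)
    also have "\<dots> = norm (\<Sum>S\<in>I. \<Prod>l<2*k. if l < k then sum (x S) (Y T j l) else cnj (sum (x S) (Y T j l)))"
      using count[of "Y T j"] YA by (simp add: G_def)
    \<comment> \<open>Passing to norms removes the conjugations, so the sides on which
      \<open>T\<close> lies do not matter: its two positions give one factor
      \<open>F (c j) S\<close>, the other \<open>2 * (k - 1)\<close> give
      \<open>F A S ^ (k - 1)\<close>.\<close>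
    also have "\<dots> \<le> (\<Sum>S\<in>I. norm (\<Prod>l<2*k. if l < k then sum (x S) (Y T j l) else cnj (sum (x S) (Y T j l))))"
      by (rule norm_sum)
    also have "\<dots> = (\<Sum>S\<in>I. \<Prod>l<2*k. norm (sum (x S) (Y T j l)))"
      unfolding norm_prod_if_cnj ..
    also have "\<dots> = (\<Sum>S\<in>I. F (c j) S * F A S ^ (k - 1))"
    proof (intro sum.cong refl)
      fix S
      have "{..<2*k} \<inter> {l. l \<in> T} = T" using finT by auto
      moreover have "card ({..<2*k} \<inter> - {l. l \<in> T}) = 2 * (k - 1)"
      proof -
        have "{..<2*k} \<inter> - {l. l \<in> T} = {..<2*k} - T" by auto
        then show ?thesis using finT by (simp add: card_Diff_subset)
      qed
      moreover have "(\<Prod>l<2*k. norm (sum (x S) (Y T j l)))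
          = (\<Prod>l<2*k. if l \<in> T then norm (sum (x S) (c j)) else norm (sum (x S) A))"
        by (intro prod.cong refl) (simp add: Y_def)
      ultimately show "(\<Prod>l<2*k. norm (sum (x S) (Y T j l))) = F (c j) S * F A S ^ (k - 1)"
        using finT by (simp add: prod.If_cases F_def power_mult)
    qed
    finally show ?thesis .
  qed
  have "(\<Sum>S\<in>I. F A S ^ k) = N * energy k A" by (simp add: en)
  also have "\<dots> \<le> N * (\<Sum>j\<in>h ` A. \<Sum>T\<in>D. real (card (G T j)))"
    using e1 N by (intro mult_left_mono) auto
  also have "\<dots> = (\<Sum>j\<in>h ` A. \<Sum>T\<in>D. N * real (card (G T j)))" by (simp add: sum_distrib_left)
  also have "\<dots> \<le> (\<Sum>j\<in>h ` A. \<Sum>T\<in>D. \<Sum>S\<in>I. F (c j) S * F A S ^ (k - 1))"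
    by (intro sum_mono e2)
  also have "\<dots> = real ((2*k) choose 2) * (\<Sum>j\<in>h ` A. \<Sum>S\<in>I. F (c j) S * F A S ^ (k - 1))"
    by (simp add: cardD sum_distrib_left)
  finally have "root k (\<Sum>S\<in>I. F A S ^ k)
      \<le> real ((2*k) choose 2) * (\<Sum>j\<in>h ` A. root k (\<Sum>S\<in>I. F (c j) S ^ k))"
    using I k by (intro root_sum_le_if_holder) (auto simp: F_def)
  moreover have "root k (\<Sum>S\<in>I. F B S ^ k) = root k N * root k (energy k B)" if "B \<subseteq> A" for B
    using that by (simp add: en[symmetric] real_root_mult)
  moreover have "c j \<subseteq> A" for j by (auto simp: c_def)
  ultimately have "root k N * root k (energy k A)
      \<le> root k N * (real ((2*k) choose 2) * (\<Sum>j\<in>h ` A. root k (energy k (c j))))"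
    by (simp add: sum_distrib_left mult_ac)
  moreover have "root k N > 0" using N k by simp
  ultimately show ?thesis unfolding c_def by (subst (asm) mult_le_cancel_left_pos) auto
qed

text \<open>The square of a sum of two norms is at most twice the sum of the squares. This is
  applied to one of the \<open>k\<close> factors \<open>F A S\<close>, and Hoelder's inequality does
  the rest.\<close>

lemma root_energy_halves:
  assumes A: "finite A" "0 \<notin> A" "-1 \<notin> A" and k: "k \<ge> 2"
  shows "root k (energy k A)
    \<le> 2 * (root k (energy k {a \<in> A. P a}) + root k (energy k {a \<in> A. \<not> P a}))"
proof -
  obtain I :: "(rat \<times> rat) set set" and x where I: "finite I" "I \<noteq> {}"
    and count: "\<And>Y. (\<forall>l<2*k. Y l \<subseteq> A) \<Longrightarrow>
      of_nat (card I * card {g \<in> PiE {..<2*k} Y. solution k g})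
      = (\<Sum>S\<in>I. \<Prod>l<2*k. if l < k then sum (x S) (Y l) else cnj (sum (x S) (Y l)))"
    using solutions_character_sum[OF A, of k] by blast
  define F where "F B S = norm (sum (x S) B) ^ 2" for B S
  define c where "c j = {a \<in> A. P a = j}" for j
  define N where "N = real (card I)"
  have N: "N > 0" using I by (simp add: N_def card_gt_0_iff)
  have cA: "c j \<subseteq> A" for j by (auto simp: c_def)
  have en: "N * energy k B = (\<Sum>S\<in>I. F B S ^ k)" if "B \<subseteq> A" for B
    using energy_eq_norm_sum[OF I(1) count that] by (simp add: N_def F_def)
  have par: "F A S \<le> 2 * (\<Sum>j\<in>UNIV. F (c j) S)" for S
  proof -
    have "sum (x S) A = sum (x S) (c True) + sum (x S) (c False)"
      using A(1) by (subst sum.union_disjoint[symmetric]) (auto simp: c_def intro!: sum.cong)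
    then have "norm (sum (x S) A) \<le> norm (sum (x S) (c True)) + norm (sum (x S) (c False))"
      by (simp add: norm_triangle_ineq)
    then have "F A S \<le> (norm (sum (x S) (c True)) + norm (sum (x S) (c False))) ^ 2"
      unfolding F_def by (intro power_mono) auto
    also have "\<dots> \<le> 2 * (F (c True) S + F (c False) S)"
      using sum_squares_bound[of "norm (sum (x S) (c True))" "norm (sum (x S) (c False))"]
      by (simp add: F_def power2_sum)
    finally show ?thesis by (simp add: UNIV_bool add.commute)
  qed
  have "(\<Sum>S\<in>I. F A S ^ k) = (\<Sum>S\<in>I. F A S * F A S ^ (k - 1))"
    using k by (cases k) auto
  also have "\<dots> \<le> (\<Sum>S\<in>I. (2 * (\<Sum>j\<in>UNIV. F (c j) S)) * F A S ^ (k - 1))"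
    using par by (intro sum_mono mult_right_mono) (auto simp: F_def)
  also have "\<dots> = (\<Sum>S\<in>I. \<Sum>j\<in>UNIV. 2 * (F (c j) S * F A S ^ (k - 1)))"
    by (simp add: sum_distrib_left sum_distrib_right mult_ac)
  also have "\<dots> = 2 * (\<Sum>j\<in>UNIV. \<Sum>S\<in>I. F (c j) S * F A S ^ (k - 1))"
    by (subst sum.swap) (simp add: sum_distrib_left)
  finally have "root k (\<Sum>S\<in>I. F A S ^ k) \<le> 2 * (\<Sum>j\<in>UNIV. root k (\<Sum>S\<in>I. F (c j) S ^ k))"
    using I k by (intro root_sum_le_if_holder) (auto simp: F_def)
  moreover have "root k (\<Sum>S\<in>I. F B S ^ k) = root k N * root k (energy k B)" if "B \<subseteq> A" for B
    using that by (simp add: en[symmetric] real_root_mult)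
  ultimately have "root k N * root k (energy k A)
      \<le> root k N * (2 * (\<Sum>j\<in>UNIV. root k (energy k (c j))))"
    using cA by (simp add: sum_distrib_left mult_ac)
  moreover have "root k N > 0" using N k by simp
  ultimately have "root k (energy k A) \<le> 2 * (\<Sum>j\<in>UNIV. root k (energy k (c j)))"
    by (subst (asm) mult_le_cancel_left_pos) auto
  then show ?thesis by (simp add: UNIV_bool c_def add.commute)
qed

text \<open>The collision lemmas need valuations of one sign, so the set is first halved by sign, at
  the cost of the factor 2. The halves have no valuation in common, so their class sums add
  up.\<close>

lemma root_energy_valuation_split:
  assumes A: "finite A" "0 \<notin> A" "-1 \<notin> A" and k: "k \<ge> 2" and p: "prime p"
  shows "root k (energy k A)
    \<le> 2 * real ((2*k) choose 2) * (\<Sum>j\<in>vp p ` A. root k (energy k {a \<in> A. vp p a = j}))"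
proof -
  define C where "C = real ((2*k) choose 2)"
  define e where "e j = root k (energy k {a \<in> A. vp p a = j})" for j
  define B where "B = {a \<in> A. vp p a \<ge> 0}"
  define B' where "B' = {a \<in> A. \<not> vp p a \<ge> 0}"
  have "root k (energy k B) \<le> C * (\<Sum>j\<in>vp p ` B. root k (energy k {a \<in> B. vp p a = j}))"
    unfolding C_def
  proof (rule root_energy_split)
    fix g assume g: "solution k g" "\<And>l. l < 2*k \<Longrightarrow> g l \<in> B"
    have "g l \<noteq> 0" "vp p (g l) \<ge> 0" if "l < 2*k" for l
      using g(2)[OF that] A(2) by (auto simp: B_def)
    then show "\<exists>l1 l2. l1 < 2*k \<and> l2 < 2*k \<and> l1 \<noteq> l2 \<and> vp p (g l1) = vp p (g l2)"
      using g(1) k p by (intro solution_valuation_collision_nonneg) auto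
  qed (use A k in \<open>auto simp: B_def\<close>)
  also have "(\<Sum>j\<in>vp p ` B. root k (energy k {a \<in> B. vp p a = j})) = (\<Sum>j\<in>vp p ` B. e j)"
    unfolding e_def
    by (intro sum.cong refl arg_cong[where f = "\<lambda>X. root k (real (energy k X))"]) (auto simp: B_def)
  finally have 1: "root k (energy k B) \<le> C * (\<Sum>j\<in>vp p ` B. e j)" .
  have "root k (energy k B') \<le> C * (\<Sum>j\<in>vp p ` B'. root k (energy k {a \<in> B'. vp p a = j}))"
    unfolding C_def
  proof (rule root_energy_split)
    fix g assume g: "solution k g" "\<And>l. l < 2*k \<Longrightarrow> g l \<in> B'"
    have "g l \<noteq> 0" "vp p (g l) < 0" if "l < 2*k" for l
      using g(2)[OF that] A(2) by (auto simp: B'_def)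
    then show "\<exists>l1 l2. l1 < 2*k \<and> l2 < 2*k \<and> l1 \<noteq> l2 \<and> vp p (g l1) = vp p (g l2)"
      using g(1) k p by (intro solution_valuation_collision_neg) auto
  qed (use A k in \<open>auto simp: B'_def\<close>)
  also have "(\<Sum>j\<in>vp p ` B'. root k (energy k {a \<in> B'. vp p a = j})) = (\<Sum>j\<in>vp p ` B'. e j)"
    unfolding e_def
    by (intro sum.cong refl arg_cong[where f = "\<lambda>X. root k (real (energy k X))"]) (auto simp: B'_def)
  finally have 2: "root k (energy k B') \<le> C * (\<Sum>j\<in>vp p ` B'. e j)" .
  have "vp p ` A = vp p ` B \<union> vp p ` B'" "vp p ` B \<inter> vp p ` B' = {}"
    by (auto simp: B_def B'_def)
  then have "(\<Sum>j\<in>vp p ` A. e j) = (\<Sum>j\<in>vp p ` B. e j) + (\<Sum>j\<in>vp p ` B'. e j)"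
    using A(1) by (simp add: sum.union_disjoint B_def B'_def)
  then have "2 * (root k (energy k B) + root k (energy k B')) \<le> 2 * C * (\<Sum>j\<in>vp p ` A. e j)"
    using 1 2 by (simp add: algebra_simps)
  moreover have "root k (energy k A) \<le> 2 * (root k (energy k B) + root k (energy k B'))"
    unfolding B_def B'_def by (rule root_energy_halves[OF A k])
  ultimately show ?thesis unfolding C_def e_def by linarith
qed

text \<open>Each prime refines the classes at the cost of one factor. In the end a class lies in
  some \<open>{a, - a}\<close>, where the trivial bound \<open>card A ^ (2 * k)\<close> is at most
  \<open>(2 * card A) ^ k\<close>. The bound is linear in \<open>card A\<close>, hence adds up over
  classes.\<close>

lemma root_energy_le:
  assumes "finite P" "\<And>p. p \<in> P \<Longrightarrow> prime p" "finite A" "0 \<notin> A" "-1 \<notin> A" "k \<ge> 2"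
    and "\<And>a b. a \<in> A \<Longrightarrow> b \<in> A \<Longrightarrow> (\<And>p. p \<in> P \<Longrightarrow> vp p a = vp p b) \<Longrightarrow> \<bar>a\<bar> = \<bar>b\<bar>"
  shows "root k (energy k A) \<le> (2 * real ((2*k) choose 2)) ^ card P * (2 * real (card A))"
  using assms
proof (induction P arbitrary: A rule: finite_induct)
  case empty
  have "card A \<le> 2"
  proof (cases "A = {}")
    case False
    then obtain a where a: "a \<in> A" by auto
    have "A \<subseteq> {a, - a}"
    proof
      fix b assume "b \<in> A"
      then have "\<bar>b\<bar> = \<bar>a\<bar>" using empty.prems(6)[of b a] a by auto
      then show "b \<in> {a, - a}" by (auto simp: abs_eq_iff)
    qed
    then have "card A \<le> card {a, - a}" by (intro card_mono) auto
    also have "\<dots> \<le> 2" by (simp add: card_insert_if)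
    finally show ?thesis .
  qed simp
  have "energy k A \<le> card ({..<2*k} \<rightarrow>\<^sub>E A)"
    unfolding energy_def using empty by (intro card_mono finite_PiE) auto
  also have "\<dots> = card A ^ (2 * k)" by (simp add: card_PiE)
  finally have "real (energy k A) \<le> (real (card A) ^ 2) ^ k"
    by (metis of_nat_le_iff of_nat_power power_mult)
  then have "root k (energy k A) \<le> root k ((real (card A) ^ 2) ^ k)"
    using empty by (intro real_root_le_mono) auto
  also have "\<dots> = real (card A) ^ 2" using empty by (intro real_root_power_cancel) auto
  also have "\<dots> \<le> 2 * real (card A)"
    using \<open>card A \<le> 2\<close> by (simp add: power2_eq_square mult_right_mono)
  finally show ?case by simp
next
  case (insert p P)
  define C where "C = 2 * real ((2*k) choose 2)"
  have "root k (energy k A) \<le> C * (\<Sum>j\<in>vp p ` A. root k (energy k {a \<in> A. vp p a = j}))"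
    unfolding C_def using insert.prems by (intro root_energy_valuation_split) auto
  also have "\<dots> \<le> C * (\<Sum>j\<in>vp p ` A. C ^ card P * (2 * real (card {a \<in> A. vp p a = j})))"
  proof (intro mult_left_mono sum_mono)
    fix j
    show "root k (energy k {a \<in> A. vp p a = j}) \<le> C ^ card P * (2 * real (card {a \<in> A. vp p a = j}))"
      unfolding C_def
    proof (rule insert.IH)
      fix a b assume "a \<in> {a \<in> A. vp p a = j}" "b \<in> {a \<in> A. vp p a = j}"
        and "\<And>q. q \<in> P \<Longrightarrow> vp q a = vp q b"
      then show "\<bar>a\<bar> = \<bar>b\<bar>" by (intro insert.prems(6)) auto
    qed (use insert.prems in auto)
  qed (simp add: C_def)
  also have "\<dots> = C ^ Suc (card P) * (2 * (\<Sum>j\<in>vp p ` A. real (card {a \<in> A. vp p a = j})))"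
    by (simp add: sum_distrib_left mult_ac)
  also have "(\<Sum>j\<in>vp p ` A. real (card {a \<in> A. vp p a = j})) = real (card A)"
    using sum.image_gen[of A "\<lambda>_. 1::real" "vp p"] insert.prems by simp
  finally show ?case using insert by (simp add: C_def)
qed

section \<open>Pluennecke's inequality and the lower bound\<close>

definition set_mult :: "rat set \<Rightarrow> rat set \<Rightarrow> rat set" where
  "set_mult X Y = (\<lambda>(x, y). x * y) ` (X \<times> Y)"

lemma set_multI: "x \<in> X \<Longrightarrow> y \<in> Y \<Longrightarrow> x * y \<in> set_mult X Y"
  by (force simp: set_mult_def)

lemma set_multE:
  assumes "w \<in> set_mult X Y"
  obtains x y where "x \<in> X" "y \<in> Y" "w = x * y"
  using assms by (auto simp: set_mult_def)

lemma finite_set_mult: "finite X \<Longrightarrow> finite Y \<Longrightarrow> finite (set_mult X Y)"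
  by (simp add: set_mult_def)

lemma set_mult_mono: "X \<subseteq> X' \<Longrightarrow> Y \<subseteq> Y' \<Longrightarrow> set_mult X Y \<subseteq> set_mult X' Y'"
  by (auto simp: set_mult_def)

lemma set_mult_empty [simp]: "set_mult X {} = {}"
  by (simp add: set_mult_def)

lemma set_mult_insert: "set_mult X (insert c C) = set_mult X C \<union> (\<lambda>x. x * c) ` X"
  by (auto simp: set_mult_def)

lemma set_mult_assoc: "set_mult (set_mult X Y) Z = set_mult X (set_mult Y Z)"
proof (intro set_eqI iffI)
  fix w assume "w \<in> set_mult (set_mult X Y) Z"
  then obtain x y z where "x \<in> X" "y \<in> Y" "z \<in> Z" "w = x * (y * z)"
    by (auto elim!: set_multE simp: mult.assoc)
  then show "w \<in> set_mult X (set_mult Y Z)" by (auto intro!: set_multI)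
next
  fix w assume "w \<in> set_mult X (set_mult Y Z)"
  then obtain x y z where "x \<in> X" "y \<in> Y" "z \<in> Z" "w = (x * y) * z"
    by (auto elim!: set_multE simp: mult.assoc)
  then show "w \<in> set_mult (set_mult X Y) Z" by (simp only: set_multI)
qed

lemma prod_set_eq_set_mult: "prod_set A = set_mult A A"
  by (auto simp: prod_set_def set_mult_def)

lemma k_fold_prod_0: "k_fold_prod X 0 = {1}"
  by (auto simp: k_fold_prod_def)

lemma k_fold_prod_Suc: "k_fold_prod X (Suc n) = set_mult X (k_fold_prod X n)"
proof (intro set_eqI iffI)
  fix w assume "w \<in> k_fold_prod X (Suc n)"
  then obtain xs where xs: "w = prod_list xs" "length xs = Suc n" "set xs \<subseteq> X"
    by (auto simp: k_fold_prod_def)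
  then obtain y ys where "xs = y # ys" by (cases xs) auto
  then show "w \<in> set_mult X (k_fold_prod X n)" using xs
    by (auto intro!: set_multI simp: k_fold_prod_def)
next
  fix w assume "w \<in> set_mult X (k_fold_prod X n)"
  then obtain y ys where "y \<in> X" "length ys = n" "set ys \<subseteq> X" "w = y * prod_list ys"
    by (auto elim!: set_multE simp: k_fold_prod_def)
  then show "w \<in> k_fold_prod X (Suc n)"
    unfolding k_fold_prod_def by (intro CollectI exI[of _ "y # ys"]) auto
qed

lemma finite_k_fold_prod: "finite X \<Longrightarrow> finite (k_fold_prod X n)"
  by (induction n) (auto simp: k_fold_prod_0 k_fold_prod_Suc finite_set_mult)

lemma zero_notin_k_fold_prod: "0 \<notin> X \<Longrightarrow> 0 \<notin> k_fold_prod X n"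
  by (auto simp: k_fold_prod_def prod_list_zero_iff)

lemma prod_in_k_fold_prod:
  assumes "\<And>l. l < k \<Longrightarrow> g l \<in> X"
  shows "(\<Prod>l<k. g l) \<in> k_fold_prod X k"
proof -
  have "(\<Prod>l<k. g l) = prod_list (map g [0..<k])"
    using prod.distinct_set_conv_list[of "[0..<k]" g] by (simp add: atLeast0LessThan)
  then show ?thesis using assms unfolding k_fold_prod_def
    by (intro CollectI exI[of _ "map g [0..<k]"]) auto
qed

text \<open>Petridis' argument: \<open>X\<close> minimises the ratio \<open>card (X B) / card X\<close> among its subsets.\<close>

lemma petridis:
  fixes \<kappa> :: real
  assumes "finite X" "finite B" "finite C" "0 \<notin> C"
    and eq: "real (card (set_mult X B)) = \<kappa> * card X"
    and min: "\<And>Z. Z \<subseteq> X \<Longrightarrow> \<kappa> * card Z \<le> real (card (set_mult Z B))"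
  shows "real (card (set_mult (set_mult X B) C)) \<le> \<kappa> * card (set_mult X C)"
  using assms(3,4)
proof (induction C rule: finite_induct)
  case empty
  then show ?case by simp
next
  case (insert c C)
  define W where "W = set_mult X C"
  \<comment> \<open>The elements \<open>x\<close> for which \<open>x * c\<close> is not new.\<close>
  define Z where "Z = {x \<in> X. x * c \<in> W}"
  have c: "c \<noteq> 0" using insert by auto
  have fin: "finite W" "finite Z" "finite (set_mult X B)" "finite (set_mult Z B)"
      "finite (set_mult (set_mult X B) C)"
    using assms insert by (auto simp: W_def Z_def finite_set_mult)
  have ZX: "Z \<subseteq> X" by (auto simp: Z_def)
  have "set_mult X (insert c C) = W \<union> (\<lambda>x. x * c) ` (X - Z)"
    unfolding set_mult_insert W_def[symmetric] by (auto simp: Z_def)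
  moreover have "W \<inter> (\<lambda>x. x * c) ` (X - Z) = {}" by (auto simp: Z_def)
  moreover have "card ((\<lambda>x. x * c) ` (X - Z)) = card X - card Z"
    using c ZX fin by (subst card_image) (auto simp: inj_on_def card_Diff_subset)
  ultimately have "card (set_mult X (insert c C)) = card W + (card X - card Z)"
    using fin assms(1) by (simp add: card_Un_disjoint)
  then have lower: "real (card (set_mult X (insert c C))) = card W + real (card X) - card Z"
    using card_mono[OF assms(1) ZX] by simp
  \<comment> \<open>From \<open>z * c = x * c'\<close> follows
    \<open>z * b * c = x * b * c'\<close>, so products from \<open>Z\<close> are not new on the
    larger side either; minimality bounds their number from below.\<close>
  have "(\<lambda>x. x * c) ` set_mult Z B \<subseteq> set_mult (set_mult X B) C"
  proof clarify
    fix w assume "w \<in> set_mult Z B"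
    then obtain z b where zb: "z \<in> Z" "b \<in> B" "w = z * b" by (rule set_multE)
    then have "z * c \<in> set_mult X C" by (simp add: Z_def W_def)
    then obtain x c' where xc: "x \<in> X" "c' \<in> C" "z * c = x * c'" by (rule set_multE)
    then have "w * c = (x * b) * c'" using zb(3) by (simp add: ac_simps)
    then show "w * c \<in> set_mult (set_mult X B) C" using xc(1,2) zb(2) by (simp only: set_multI)
  qed
  then have "set_mult (set_mult X B) (insert c C)
      \<subseteq> set_mult (set_mult X B) C \<union> (\<lambda>x. x * c) ` (set_mult X B - set_mult Z B)"
    unfolding set_mult_insert by auto
  then have "card (set_mult (set_mult X B) (insert c C))
      \<le> card (set_mult (set_mult X B) C \<union> (\<lambda>x. x * c) ` (set_mult X B - set_mult Z B))"
    using fin by (intro card_mono) auto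
  also have "\<dots> \<le> card (set_mult (set_mult X B) C) + card ((\<lambda>x. x * c) ` (set_mult X B - set_mult Z B))"
    by (rule card_Un_le)
  also have "\<dots> \<le> card (set_mult (set_mult X B) C) + card (set_mult X B - set_mult Z B)"
    using fin by (intro add_left_mono card_image_le) auto
  also have "card (set_mult X B - set_mult Z B) = card (set_mult X B) - card (set_mult Z B)"
    using fin ZX by (intro card_Diff_subset set_mult_mono) auto
  finally have "real (card (set_mult (set_mult X B) (insert c C)))
      \<le> card (set_mult (set_mult X B) C) + real (card (set_mult X B)) - card (set_mult Z B)"
    using card_mono[OF fin(3) set_mult_mono[OF ZX order_refl, of B]] by linarith
  also have "\<dots> \<le> \<kappa> * card W + \<kappa> * card X - \<kappa> * card Z"
    using insert eq min[OF ZX] by (simp add: W_def)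
  also have "\<dots> = \<kappa> * card (set_mult X (insert c C))" unfolding lower by (simp add: algebra_simps)
  finally show ?case .
qed

text \<open>For a subset \<open>X\<close> minimising the ratio \<open>r\<close>, multiplying by
  \<open>B\<close> once more costs a factor \<open>r X\<close> by \<open>petridis\<close>. The set
  \<open>X\<close> times the \<open>k\<close>-fold product set contains a dilate of the latter, and
  \<open>r X \<le> r B\<close>.\<close>

lemma pluennecke:
  assumes "finite B" "0 \<notin> B" "B \<noteq> {}"
  shows "real (card (k_fold_prod B k)) \<le> (card (prod_set B) / card B) ^ k * card B"
proof -
  define r where "r X = real (card (set_mult X B)) / card X" for X
  have "\<exists>X. is_arg_min r (\<lambda>X. X \<in> Pow B - {{}}) X"
    using assms by (intro ex_is_arg_min_if_finite) auto
  then obtain X where X: "X \<subseteq> B" "X \<noteq> {}"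
    and min: "\<And>Z. Z \<subseteq> B \<Longrightarrow> Z \<noteq> {} \<Longrightarrow> r X \<le> r Z"
    unfolding is_arg_min_linorder by auto
  have finX: "finite X" using X assms finite_subset by blast
  have cX: "card X > 0" using finX X by (simp add: card_gt_0_iff)
  have r0: "r X \<ge> 0" by (simp add: r_def)
  have iter: "real (card (set_mult X (k_fold_prod B n))) \<le> r X ^ n * card X" for n
  proof (induction n)
    case 0
    then show ?case by (simp add: k_fold_prod_0 set_mult_insert)
  next
    case (Suc n)
    have "real (card (set_mult (set_mult X B) (k_fold_prod B n)))
        \<le> r X * card (set_mult X (k_fold_prod B n))"
    proof (rule petridis)
      show "real (card (set_mult X B)) = r X * card X" using cX by (simp add: r_def)
      fix Z assume Z: "Z \<subseteq> X"
      show "r X * card Z \<le> real (card (set_mult Z B))"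
      proof (cases "Z = {}")
        case False
        then have "card Z > 0" using Z finX finite_subset by (auto simp: card_gt_0_iff)
        then show ?thesis using min[of Z] Z X False by (simp add: r_def[of Z] le_divide_eq)
      qed simp
    qed (use assms finX in \<open>auto simp: finite_k_fold_prod zero_notin_k_fold_prod\<close>)
    also have "\<dots> \<le> r X * (r X ^ n * card X)" using Suc r0 by (rule mult_left_mono)
    finally show ?case by (simp add: k_fold_prod_Suc set_mult_assoc mult_ac)
  qed
  obtain x where x: "x \<in> X" using X by auto
  have "card (k_fold_prod B k) = card ((*) x ` k_fold_prod B k)"
    using x X assms by (intro card_image[symmetric] inj_onI) auto
  also have "\<dots> \<le> card (set_mult X (k_fold_prod B k))"
    using x assms finX by (intro card_mono finite_set_mult finite_k_fold_prod) (auto intro: set_multI)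
  finally have "real (card (k_fold_prod B k)) \<le> r X ^ k * card X" using iter[of k] by linarith
  also have "\<dots> \<le> r B ^ k * card B"
    using min[of B] assms X r0 by (intro mult_mono power_mono) (auto simp: card_mono r_def)
  finally show ?thesis by (simp add: r_def prod_set_eq_set_mult)
qed

section \<open>Energy against product sets\<close>

text \<open>Cauchy--Schwarz for the map sending a \<open>k\<close>-tuple to its two products: the
  squared fibre sizes sum to at most the energy, and the image lies in the product of the two
  \<open>k\<close>-fold product sets.\<close>

lemma energy_lower_bound:
  assumes "finite B"
  shows "real (card B) ^ (2 * k)
    \<le> real (energy k B) * (real (card (k_fold_prod B k)) * real (card (k_fold_prod ((\<lambda>b. 1 + b) ` B) k)))"
proof -
  define G where "G = {..<k} \<rightarrow>\<^sub>E B"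
  define \<phi> :: "(nat \<Rightarrow> rat) \<Rightarrow> rat \<times> rat" where "\<phi> g = (\<Prod>l<k. g l, \<Prod>l<k. 1 + g l)" for g
  define V where "V = \<phi> ` G"
  define fib where "fib v = {g \<in> G. \<phi> g = v}" for v
  have finG: "finite G" unfolding G_def using assms by (intro finite_PiE) auto
  then have fin: "finite V" "finite (fib v)" for v by (auto simp: V_def fib_def)
  have cardG: "card G = card B ^ k" by (simp add: G_def card_PiE)
  have "V \<subseteq> k_fold_prod B k \<times> k_fold_prod ((\<lambda>b. 1 + b) ` B) k"
    unfolding V_def \<phi>_def G_def by (auto intro!: prod_in_k_fold_prod)
  then have "card V \<le> card (k_fold_prod B k \<times> k_fold_prod ((\<lambda>b. 1 + b) ` B) k)"
    using assms by (intro card_mono finite_cartesian_product finite_k_fold_prod) auto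
  then have cardV: "real (card V) \<le> real (card (k_fold_prod B k)) * real (card (k_fold_prod ((\<lambda>b. 1 + b) ` B) k))"
    unfolding card_cartesian_product by (metis of_nat_le_iff of_nat_mult)
  \<comment> \<open>Concatenates two tuples of the same fibre into one of length
    \<open>2 * k\<close>.\<close>
  define J where "J = (\<lambda>(v :: rat \<times> rat, g, g'). \<lambda>l\<in>{..<2*k}. if l < k then g l else g' (l - k) :: rat)"
  define \<Sigma> where "\<Sigma> = (SIGMA v:V. fib v \<times> fib v)"
  have "inj_on J \<Sigma>"
  proof (rule inj_onI)
    fix s t assume st: "s \<in> \<Sigma>" "t \<in> \<Sigma>" "J s = J t"
    obtain v g g' w h h' where s: "s = (v, g, g')" and t: "t = (w, h, h')"
      by (cases s; cases t) auto
    note 1 = st(1,2)[unfolded s t] and eq = st(3)[unfolded s t]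
    have G: "g \<in> G" "g' \<in> G" "h \<in> G" "h' \<in> G" "\<phi> g = v" "\<phi> h = w"
      using 1 by (auto simp: \<Sigma>_def fib_def)
    have "g l = h l" if "l < k" for l
      using fun_cong[OF eq, of l] that by (simp add: J_def)
    then have "g = h" using G by (intro PiE_ext[of g "{..<k}" "\<lambda>_. B" h]) (auto simp: G_def)
    have "g' l = h' l" if "l < k" for l
      using fun_cong[OF eq, of "l + k"] that by (simp add: J_def)
    then have "g' = h'" using G by (intro PiE_ext[of g' "{..<k}" "\<lambda>_. B" h']) (auto simp: G_def)
    then show "s = t" using \<open>g = h\<close> G s t by auto
  qed
  then have "card \<Sigma> = card (J ` \<Sigma>)" by (rule card_image[symmetric])
  also have "\<dots> \<le> energy k B"
    unfolding energy_def
  proof (intro card_mono subsetI)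
    show "finite {g \<in> {..<2*k} \<rightarrow>\<^sub>E B. solution k g}"
      using assms by (auto intro!: finite_PiE)
    fix f assume "f \<in> J ` \<Sigma>"
    then obtain v g g' where f: "f = J (v, g, g')" and "(v, g, g') \<in> \<Sigma>" by auto
    then have G: "g \<in> G" "g' \<in> G" "\<phi> g = \<phi> g'" by (auto simp: \<Sigma>_def fib_def)
    have "f \<in> {..<2*k} \<rightarrow>\<^sub>E B"
      unfolding f J_def using G by (auto simp: G_def PiE_iff)
    moreover have "solution k f"
    proof -
      have up: "(\<Prod>l=k..<2*k. c (f l)) = (\<Prod>l<k. c (g' l))" for c :: "rat \<Rightarrow> rat"
      proof -
        have "(\<Prod>l=k..<2*k. c (f l)) = (\<Prod>l=0+k..<k+k. c (f l))" by (simp add: mult_2)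
        also have "\<dots> = (\<Prod>l=0..<k. c (f (l + k)))" by (rule prod.shift_bounds_nat_ivl)
        also have "\<dots> = (\<Prod>l<k. c (g' l))"
          by (intro prod.cong) (auto simp: f J_def)
        finally show ?thesis .
      qed
      have low: "(\<Prod>l<k. c (f l)) = (\<Prod>l<k. c (g l))" for c :: "rat \<Rightarrow> rat"
        by (intro prod.cong) (auto simp: f J_def)
      show ?thesis
        unfolding solution_def using up[of "\<lambda>x. x"] up[of "\<lambda>x. 1 + x"] low[of "\<lambda>x. x"] low[of "\<lambda>x. 1 + x"] G(3)
        by (simp add: \<phi>_def)
    qed
    ultimately show "f \<in> {g \<in> {..<2*k} \<rightarrow>\<^sub>E B. solution k g}" by simp
  qed
  finally have en: "card \<Sigma> \<le> energy k B" .
  have cS: "(\<Sum>v\<in>V. (real (card (fib v)))\<^sup>2) = real (card \<Sigma>)"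
    unfolding \<Sigma>_def using fin
    by (subst card_SigmaI) (auto simp: card_cartesian_product power2_eq_square)
  have "real (card G) = (\<Sum>v\<in>V. real (card (fib v)))"
    using sum.image_gen[OF finG, of "\<lambda>_. 1::real" \<phi>] by (simp add: V_def fib_def)
  then have "(real (card G))\<^sup>2 = (\<Sum>v\<in>V. real (card (fib v)))\<^sup>2" by simp
  also have "\<dots> \<le> (\<Sum>v\<in>V. (real (card (fib v)))\<^sup>2) * card V"
    by (rule sum_squared_le_sum_of_squares)
  also have "\<dots> \<le> real (energy k B) * (real (card (k_fold_prod B k)) * real (card (k_fold_prod ((\<lambda>b. 1 + b) ` B) k)))"
    unfolding cS using en cardV by (intro mult_mono) auto
  finally show ?thesis by (simp add: cardG power_mult[symmetric] mult.commute)
qed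

section \<open>Assembling the estimates\<close>

text \<open>If \<open>d + 1\<close> coordinates including \<open>None\<close> never sufficed,
  Freiman's lemma would make \<open>card (prod_set B)\<close> at least
  \<open>(d + 2) * (card B - (d + 1))\<close>, which exceeds \<open>K * n\<close>. Since
  \<open>None\<close> takes one coordinate, at most \<open>d\<close> primes remain.\<close>

lemma few_primes_determine:
  fixes K n :: real
  assumes B: "finite B" "0 \<notin> B" and K: "K \<ge> 1" and n: "n > 12 * K^2"
    and N: "real (card B) \<ge> n - 2" and small: "real (card (prod_set B)) \<le> K * n"
  shows "\<exists>P. finite P \<and> (\<forall>p\<in>P. prime p) \<and> real (card P) \<le> K - 1/2 \<and>
    (\<forall>a\<in>B. \<forall>b\<in>B. (\<forall>p\<in>P. vp p a = vp p b) \<longrightarrow> \<bar>a\<bar> = \<bar>b\<bar>)"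
proof -
  \<comment> \<open>Subtracting \<open>1/2\<close> saves half an exponent for the constants of the
    final estimate and still leaves \<open>d + 2 > K + 1/2\<close>.\<close>
  define d where "d = nat \<lfloor>K - 1/2\<rfloor>"
  have d: "real d \<le> K - 1/2" "K - 1/2 < real d + 1"
    unfolding d_def using K by linarith+
  have "\<exists>Q. finite Q \<and> None \<in> Q \<and> card Q \<le> d + 1 \<and> determines Q (val_vec ` B)"
  proof (rule ccontr)
    assume "\<not> ?thesis"
    then have "(d + 1 + 1) * card B \<le> card (prod_set B) + (d + 1) * (d + 1 + 1)"
      using B by (intro freiman_lemma) auto
    then have "real ((d + 1 + 1) * card B) \<le> real (card (prod_set B) + (d + 1) * (d + 1 + 1))"
      by (simp only: of_nat_le_iff)
    then have 1: "(real d + 2) * (real (card B) - (real d + 1)) \<le> K * n"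
      using small by (simp add: algebra_simps)
    have K2: "K \<le> K^2" "1 \<le> K^2"
      using K self_le_power[of K 2] one_le_power[of K 2] by simp_all
    have 2: "n - K - 5/2 \<le> real (card B) - (real d + 1)" using N d by linarith
    have "(K + 1/2) * (n - K - 5/2) \<le> (real d + 2) * (real (card B) - (real d + 1))"
    proof (rule mult_mono[OF _ 2])
      show "K + 1/2 \<le> real d + 2" using d by linarith
      show "0 \<le> n - K - 5/2" using K K2 n by linarith
    qed simp
    then have "(K + 1/2) * (n - K - 5/2) \<le> K * n" using 1 by linarith
    moreover have "(K + 1/2) * (n - K - 5/2) = K * n + n/2 - K^2 - 3 * K - 5/4"
      by (simp add: field_simps power2_eq_square)
    ultimately have "n \<le> 2 * K^2 + 6 * K + 5/2" by linarith
    then show False using n K2 by linarith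
  qed
  then obtain Q where Q: "finite Q" "None \<in> Q" "card Q \<le> d + 1" "determines Q (val_vec ` B)"
    by blast
  define P where "P = {p. Some p \<in> Q \<and> prime p}"
  have SP: "Some ` P \<subseteq> Q - {None}" by (auto simp: P_def)
  have finP: "finite P" using finite_subset[OF SP] Q(1) by (simp add: finite_image_iff)
  have "card P = card (Some ` P)" by (simp add: card_image)
  also have "\<dots> \<le> card (Q - {None})" using SP Q(1) by (intro card_mono) auto
  also have "\<dots> \<le> d" using Q by simp
  finally have "real (card P) \<le> K - 1/2" using d by linarith
  moreover have "\<forall>p\<in>P. prime p" by (simp add: P_def)
  moreover have "\<forall>a\<in>B. \<forall>b\<in>B. (\<forall>p\<in>P. vp p a = vp p b) \<longrightarrow> \<bar>a\<bar> = \<bar>b\<bar>"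
  proof (intro ballI impI)
    fix a b assume ab: "a \<in> B" "b \<in> B" "\<forall>p\<in>P. vp p a = vp p b"
    show "\<bar>a\<bar> = \<bar>b\<bar>"
    proof (rule determines_imp_abs_eq[OF Q(4) ab(1,2)])
      show "a \<noteq> 0" "b \<noteq> 0" using ab B by auto
      show "vp p a = vp p b" if "Some p \<in> Q" "prime p" for p
        using ab(3) that by (simp add: P_def)
    qed
  qed
  ultimately show ?thesis using finP by (intro exI[of _ P] conjI)
qed

lemma two_choose_two_ge:
  assumes "k \<ge> 2"
  shows "2 * real ((2*k) choose 2) \<ge> 12"
proof -
  have "4 choose 2 \<le> (2*k) choose 2" using assms by (intro binomial_right_mono) auto
  moreover have "(4::nat) choose 2 = 6" by (simp add: numeral_eq_Suc)
  ultimately show ?thesis by linarith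
qed

text \<open>Upper and lower bound for the energy are compared, with Pluennecke's inequality for the
  plain products. Here \<open>n\<close> is the size of the original set, of which \<open>B\<close>
  has lost at most two elements.\<close>

lemma shifted_product_bound:
  fixes K n :: real
  assumes B: "finite B" "0 \<notin> B" "-1 \<notin> B" and K: "K \<ge> 1" and n: "n > 12 * K^2" and k: "k \<ge> 2"
    and N: "real (card B) \<ge> n - 2" and small: "real (card (prod_set B)) \<le> K * n"
  shows "n ^ (k - 1) \<le> (K * (2 * real ((2*k) choose 2)) powr K) ^ k
    * card (k_fold_prod ((\<lambda>b. 1 + b) ` B) k)"
proof -
  define c where "c = 2 * real ((2*k) choose 2)"
  define N where "N = real (card B)"
  define W where "W = real (card (k_fold_prod ((\<lambda>b. 1 + b) ` B) k))"
  obtain P where P: "finite P" "\<forall>p\<in>P. prime p" "real (card P) \<le> K - 1/2"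
      "\<forall>a\<in>B. \<forall>b\<in>B. (\<forall>p\<in>P. vp p a = vp p b) \<longrightarrow> \<bar>a\<bar> = \<bar>b\<bar>"
    using few_primes_determine[OF B(1,2) K n N small] by (elim exE conjE)
  define m where "m = c ^ card P"
  have K2: "K \<le> K^2" "1 \<le> K^2"
      using K self_le_power[of K 2] one_le_power[of K 2] by simp_all
  have n12: "n > 12" using n K2 by linarith
  have nN: "n \<le> 6/5 * N" using N n12 by (simp add: N_def)
  then have Npos: "N > 0" using n12 by simp
  then have Bne: "B \<noteq> {}" by (auto simp: N_def)
  have c12: "c \<ge> 12"
    unfolding c_def using k by (rule two_choose_two_ge)
  have m0: "m > 0" using c12 by (simp add: m_def)
  have W0: "W \<ge> 0" by (simp add: W_def)
  \<comment> \<open>The constant is \<open>2 * (6/5) ^ 2\<close>, from the 2 in the energy bound and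
    the passage between \<open>n\<close> and \<open>N\<close>. It is below \<open>sqrt 12\<close>,
    so the spare exponent \<open>1/2\<close> pays for it.\<close>
  have mc: "72/25 * m \<le> c powr K"
  proof -
    have "sqrt ((72/25)^2) \<le> sqrt (c)" using c12 by (intro real_sqrt_le_mono) (simp add: power2_eq_square)
    then have "72/25 \<le> sqrt (c)" by simp
    then have "72/25 * m \<le> sqrt (c) * m" using m0 by (intro mult_right_mono) auto
    also have "\<dots> = c powr (1/2) * c powr (real (card P))"
      using c12 by (simp add: m_def powr_half_sqrt powr_realpow)
    also have "\<dots> = c powr (1/2 + real (card P))" by (simp add: powr_add)
    also have "\<dots> \<le> c powr K" using P(3) c12 by (intro powr_mono) auto
    finally show ?thesis .
  qed
  have "root k (energy k B) \<le> m * (2 * N)"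
    unfolding m_def c_def N_def
  proof (rule root_energy_le[OF P(1) _ B k])
    show "prime p" if "p \<in> P" for p using P(2) that by simp
    show "\<bar>a\<bar> = \<bar>b\<bar>" if "a \<in> B" "b \<in> B" "\<And>p. p \<in> P \<Longrightarrow> vp p a = vp p b" for a b
      by (rule P(4)[rule_format, OF that])
  qed
  then have "root k (energy k B) ^ k \<le> (m * (2 * N)) ^ k"
    using k by (intro power_mono real_root_ge_zero) auto
  then have en: "real (energy k B) \<le> (m * (2 * N)) ^ k" using k by (simp add: real_root_pow_pos2)
  have "real (card (k_fold_prod B k)) \<le> (card (prod_set B) / N) ^ k * N"
    unfolding N_def by (rule pluennecke[OF B(1,2) Bne])
  also have "\<dots> \<le> (K * n / N) ^ k * N"
    using small Npos by (intro mult_right_mono power_mono divide_right_mono) auto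
  finally have pl: "real (card (k_fold_prod B k)) \<le> (K * n / N) ^ k * N" .
  have "N ^ (2 * k - 1) * N = N ^ (2 * k)" using k by (cases k) auto
  also have "\<dots> \<le> real (energy k B) * (real (card (k_fold_prod B k)) * W)"
    unfolding N_def W_def by (rule energy_lower_bound[OF B(1)])
  also have "\<dots> \<le> (m * (2 * N)) ^ k * (((K * n / N) ^ k * N) * W)"
    using en pl W0 m0 Npos by (intro mult_mono mult_right_mono mult_nonneg_nonneg) auto
  also have "\<dots> = ((m * (2 * N)) * (K * n / N)) ^ k * W * N" by (simp only: power_mult_distrib mult_ac)
  also have "(m * (2 * N)) * (K * n / N) = 2 * m * K * n" using Npos by simp
  finally have main: "N ^ (2 * k - 1) \<le> (2 * m * K * n) ^ k * W"
    using Npos by (subst (asm) mult_le_cancel_right_pos) auto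
  have "n ^ k * n ^ (k - 1) = n ^ (2 * k - 1)" using k by (simp add: power_add[symmetric] mult_2)
  also have "\<dots> \<le> (6/5 * N) ^ (2 * k - 1)" using nN n12 by (intro power_mono) auto
  also have "\<dots> = (6/5) ^ (2 * k - 1) * N ^ (2 * k - 1)" by (rule power_mult_distrib)
  also have "\<dots> \<le> (6/5) ^ (2 * k) * ((2 * m * K * n) ^ k * W)"
    using main Npos by (intro mult_mono power_increasing) auto
  also have "\<dots> = ((72/25 * m) * K * n) ^ k * W"
    by (simp add: power_mult power_mult_distrib[symmetric] power2_eq_square mult_ac)
  also have "\<dots> \<le> (c powr K * K * n) ^ k * W"
    using mc m0 K n12 W0 by (intro mult_right_mono power_mono) auto
  also have "\<dots> = n ^ k * ((K * c powr K) ^ k * W)" by (simp add: power_mult_distrib mult_ac)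
  finally show ?thesis
    unfolding W_def c_def using n12 by (subst (asm) mult_le_cancel_left_pos) auto
qed

text \<open>\<open>K \<le> exp (K - 1) \<le> 12 powr (K - 1)\<close>, as
  \<open>ln 12 \<ge> 1\<close>. Consequently a set larger than \<open>K * c powr K\<close> has more
  than \<open>12 * K^2\<close> elements.\<close>

lemma twelve_mult_le_powr:
  fixes K c :: real
  assumes "K \<ge> 1" "c \<ge> 12"
  shows "12 * K \<le> c powr K"
proof -
  have "exp 1 \<le> (12::real)" using exp_le by linarith
  then have "1 \<le> ln (12::real)" by (simp add: ln_ge_iff)
  then have "K - 1 \<le> (K - 1) * ln 12" using assms(1) mult_left_mono[of 1 "ln 12" "K - 1"] by simp
  then have "K \<le> 1 + (K - 1) * ln 12" by simp
  also have "\<dots> \<le> exp ((K - 1) * ln 12)" by (rule exp_ge_add_one_self)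
  also have "\<dots> = 12 powr (K - 1)" by (simp add: powr_def)
  finally have "12 * K \<le> 12 powr 1 * 12 powr (K - 1)" by simp
  also have "\<dots> = 12 powr K" by (simp only: powr_add[symmetric]) simp
  also have "\<dots> \<le> c powr K" using assms by (intro powr_mono2) auto
  finally show ?thesis .
qed

lemma card_image_divide: "finite X \<Longrightarrow> u \<noteq> 0 \<Longrightarrow> card ((\<lambda>a. a / u) ` X) = card X" for u :: rat
  by (intro card_image) (auto simp: inj_on_def)

theorem mainTheorem14:
  fixes A :: "rat set" and K :: real and u :: rat and k :: nat
  assumes "finite A"
    and "real (card (prod_set A)) \<le> K * real (card A)"
    and "u \<noteq> 0"
    and "k \<ge> 2"
  shows "real (card (k_fold_prod (translate A u) k))
    \<ge> real (card A) ^ (k - 1) / (K ^ k * (2 * real ((2 * k) choose 2)) powr (K * real k))"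
proof (cases "A = {}")
  case True
  \<comment> \<open>The bound reads 0, because \<open>k - 1\<close> is positive.\<close>
  then show ?thesis using assms(4) by (simp add: power_0_left)
next
  case False
  define n where "n = real (card A)"
  define c where "c = 2 * real ((2 * k) choose 2)"
  define L where "L = K * c powr K"
  define W where "W = card (k_fold_prod (translate A u) k)"
  have npos: "n > 0" using False assms(1) by (simp add: n_def card_gt_0_iff)
  have fint: "finite (translate A u)" using assms(1) by (simp add: translate_def)
  have "card A \<le> card (prod_set A)"
  proof (cases "\<exists>a\<in>A. a \<noteq> 0")
    case True
    then obtain a where a: "a \<in> A" "a \<noteq> 0" by auto
    have "card A = card ((*) a ` A)" using a by (intro card_image[symmetric] inj_onI) auto
    also have "\<dots> \<le> card (prod_set A)"
      using a assms by (intro card_mono finite_prod_set) (auto simp: prod_set_def)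
    finally show ?thesis .
  next
    case F: False
    then have "A = {0}" using False by auto
    then show ?thesis by (simp add: prod_set_def)
  qed
  then have "1 * n \<le> K * n" using assms(2) by (simp add: n_def)
  then have K: "K \<ge> 1" using npos by (subst (asm) mult_le_cancel_right_pos) auto
  have c12: "c \<ge> 12"
    unfolding c_def using assms(4) by (rule two_choose_two_ge)
  have "K * (12 * K) \<le> L" unfolding L_def using twelve_mult_le_powr[OF K c12] K by (intro mult_left_mono) auto
  then have L: "12 * K^2 \<le> L" by (simp add: power2_eq_square)
  moreover have "1 \<le> K^2" using K by simp
  ultimately have L1: "L \<ge> 1" by linarith
  have den: "K ^ k * c powr (K * real k) = L ^ k"
    using c12 by (simp add: L_def power_mult_distrib powr_powr[symmetric] powr_realpow)
  have "n ^ (k - 1) \<le> L ^ k * W"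
  \<comment> \<open>For small \<open>A\<close> a single product suffices; otherwise
    \<open>n > L\<close>, and the main estimate applies.\<close>
  proof (cases "n ^ (k - 1) \<le> L ^ k")
    case True
    obtain a where "a \<in> A" using False by auto
    then have "(\<Prod>l<k. a + u) \<in> k_fold_prod (translate A u) k"
      by (intro prod_in_k_fold_prod) (auto simp: translate_def)
    then have "W \<ge> 1" unfolding W_def
      using card_gt_0_iff[of "k_fold_prod (translate A u) k"] finite_k_fold_prod[OF fint] by fastforce
    then have "L ^ k * 1 \<le> L ^ k * W" using L1 by (intro mult_left_mono) auto
    then show ?thesis using True by linarith
  next
    case F: False
    have "n > L"
    proof (rule ccontr)
      assume "\<not> n > L"
      then have "n ^ (k - 1) \<le> L ^ (k - 1)" using npos by (intro power_mono) auto
      also have "\<dots> \<le> L ^ k" using L1 by (intro power_increasing) auto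
      finally show False using F by simp
    qed
    then have n12: "n > 12 * K^2" using L by simp
    \<comment> \<open>Without 0 and \<open>- u\<close> both \<open>b\<close> and
      \<open>1 + b\<close> are nonzero after division by \<open>u\<close>, as valuations and
      characters require.\<close>
    define A2 where "A2 = A - {0, - u}"
    define B where "B = (\<lambda>a. a / u) ` A2"
    have finA2: "finite A2" using assms(1) by (simp add: A2_def)
    have cB: "card B = card A2" unfolding B_def using finA2 assms(3) by (rule card_image_divide)
    have "card A \<le> card A2 + card {0, - u}"
    proof -
      have "card A \<le> card (A2 \<union> {0, - u})" using finA2 by (intro card_mono) (auto simp: A2_def)
      also have "\<dots> \<le> card A2 + card {0, - u}" by (rule card_Un_le)
      finally show ?thesis .
    qed
    then have NB: "real (card B) \<ge> n - 2"
      using assms(3) cB by (simp add: n_def)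
    have "prod_set B = (\<lambda>a. a / u^2) ` prod_set A2"
    proof (intro set_eqI iffI)
      fix w assume "w \<in> prod_set B"
      then obtain a b where "a \<in> A2" "b \<in> A2" "w = (a / u) * (b / u)"
        by (auto simp: prod_set_def B_def)
      then show "w \<in> (\<lambda>a. a / u^2) ` prod_set A2"
        by (intro image_eqI[of _ _ "a * b"]) (auto simp: prod_set_def power2_eq_square)
    next
      fix w assume "w \<in> (\<lambda>a. a / u^2) ` prod_set A2"
      then obtain a b where ab: "a \<in> A2" "b \<in> A2" "w = (a * b) / u^2"
        by (auto simp: prod_set_def)
      then have "w = (a / u) * (b / u)" by (simp add: power2_eq_square)
      then show "w \<in> prod_set B" using ab(1,2) unfolding prod_set_def B_def by blast
    qed
    then have "card (prod_set B) = card (prod_set A2)"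
      using finA2 assms(3) by (simp add: card_image_divide finite_prod_set)
    also have "\<dots> \<le> card (prod_set A)"
      using assms(1) by (intro card_mono finite_prod_set prod_set_mono) (auto simp: A2_def)
    finally have small: "real (card (prod_set B)) \<le> K * n" using assms(2) by (simp add: n_def)
    have B: "finite B" "0 \<notin> B" "-1 \<notin> B"
      using finA2 assms(3) by (auto simp: B_def A2_def field_simps eq_neg_iff_add_eq_0)
    have "card (k_fold_prod ((\<lambda>b. 1 + b) ` B) k) \<le> W"
    proof -
      \<comment> \<open>Each of the \<open>k\<close> factors \<open>1 + a / u\<close> becomes
        \<open>a + u\<close> when multiplied by \<open>u\<close>.\<close>
      have "(\<lambda>x. u ^ k * x) ` k_fold_prod ((\<lambda>b. 1 + b) ` B) k \<subseteq> k_fold_prod (translate A u) k"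
      proof clarify
        fix x assume "x \<in> k_fold_prod ((\<lambda>b. 1 + b) ` B) k"
        then obtain xs where xs: "x = prod_list xs" "length xs = k" "set xs \<subseteq> (\<lambda>b. 1 + b) ` B"
          by (auto simp: k_fold_prod_def)
        have "prod_list (map ((*) u) ys) = u ^ length ys * prod_list ys" for ys
          by (induction ys) (auto simp: ac_simps)
        moreover have "set (map ((*) u) xs) \<subseteq> translate A u"
          using xs(3) assms(3) by (force simp: translate_def B_def A2_def distrib_left)
        ultimately show "u ^ k * x \<in> k_fold_prod (translate A u) k"
          unfolding k_fold_prod_def using xs by (intro CollectI exI[of _ "map ((*) u) xs"]) auto
      qed
      then have "card ((\<lambda>x. u ^ k * x) ` k_fold_prod ((\<lambda>b. 1 + b) ` B) k) \<le> W"
        unfolding W_def using fint by (intro card_mono finite_k_fold_prod)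
      then show ?thesis using assms(3) by (subst (asm) card_image) (auto simp: inj_on_def)
    qed
    moreover have "n ^ (k - 1) \<le> L ^ k * card (k_fold_prod ((\<lambda>b. 1 + b) ` B) k)"
      unfolding L_def c_def using shifted_product_bound[OF B K n12 assms(4) NB small] by simp
    moreover have "L ^ k \<ge> 0" using L1 by simp
    ultimately show ?thesis by (meson mult_left_mono of_nat_le_iff order_trans)
  qed
  then show ?thesis
    unfolding n_def[symmetric] c_def[symmetric] den W_def using L1 by (simp add: divide_le_eq mult.commute)
qed

end
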